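(* Let $n\ge 1$, $0<\xi_1<\dots<\xi_n<1$, $g_i>0$, $g=\sum_{i=1}^n g_i\delta_{\xi_i}$. Let $(a,b)$ be one of the pairs $(0,0),(0,1),(1,2),(2,2)$, with associated spectral measures $d\alpha,d\beta$, Cauchy pairing $\langle\cdot|\cdot\rangle$ and generalized Fourier transforms (all defined in the context). For $j=0,\dots,n-1$ let $\chi_j$ be the indicator function of the interval $(\xi_{n-j}-\epsilon,\xi_{n-j}+\epsilon)$, where $\epsilon>0$ is small enough that these intervals are pairwise disjoint, and define $$p_j(x):=\hat\chi_{a,j}(x),\qquad q_j(y):=\hat\chi_{b,j}(y),$$ where $\hat\chi_{a,j}$ denotes the generalized Fourier transform of Type $a$ of $\chi_j$. Then $\{p_j\},\{q_k\}$ are (un-normalized) Cauchy biorthogonal polynomials: $p_j$ and $q_j$ are polynomials of degree $j$, $\langle p_i|q_j\rangle=0$ for $i\neq j$, and $\langle p_i|q_i\rangle\neq 0$.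
   Context: $L^2_g[0,1]$ is the space of functions on $[0,1]$ with the bilinear inner product $(f,h)_g=\int_0^1 f h\,g\,d\xi=\sum_{i=1}^n g_i f(\xi_i)h(\xi_i)$. For $z\in\mathbb{C}$, $\phi(\xi;z)$ is the solution, in the sense of distributions, of $-\phi_{\xi\xi\xi}=z\,g\,\phi$ on $(0,1)$ with $\phi(0)=\phi_\xi(0)=0$, $\phi_{\xi\xi}(0)=1$; that is, $\phi$ is $C^1$, is a quadratic polynomial in $\xi$ between consecutive masses, and $\phi_{\xi\xi}(\xi_i+0)-\phi_{\xi\xi}(\xi_i-0)=-z g_i\phi(\xi_i)$. For $a=0,1,2$, $\phi_a^*(\xi;z)$ is the solution of $\phi^*_{\xi\xi\xi}=z\,g\,\phi^*$ (same sense, with jump $+z g_i\phi^*(\xi_i)$ of $\phi^*_{\xi\xi}$ at $\xi_i$) with the following values at $\xi=1$: for $a=0$, $\phi^*=\phi^*_\xi=0$, $\phi^*_{\xi\xi}=1$; for $a=1$, $\phi^*=\phi^*_{\xi\xi}=0$, $\phi^*_\xi=1$; for $a=2$, $\phi^*_\xi=\phi^*_{\xi\xi}=0$, $\phi^*=1$. The spectrum of Type $a$, $\{z_{a,j}\}_{j=1}^n$, is the set of zeros in $z$ of $\phi(1;z)$ for $a=0$, of $\phi_\xi(1;z)$ for $a=1$, of $\phi_{\xi\xi}(1;z)$ for $a=2$ (each of these polynomials in $z$ has exactly $n$ zeros, all simple and positive). The generalized Fourier transform of Type $a$ of $f\in L^2_g[0,1]$ is $\hat f_a(z)=(-1)^a\int_0^1\phi_a^*(\xi;z)f(\xi)g(\xi)\,d\xi=(-1)^a(\phi_a^*(\cdot;z),f)_g$.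 The measures for the pair $(a,b)$ are $d\alpha=\sum_{i}A_i\delta_{z_{a,i}}$, $d\beta=\sum_j B_j\delta_{z_{b,j}}$, with (subscript $z$ denoting $\partial/\partial z$): - $(0,0)$: $A_i=\frac{\phi_\xi(1;z_{0,i})}{\phi_z(1;z_{0,i})}$, $B_j=\frac{\phi_\xi(1;z_{0,j})}{\phi_z(1;z_{0,j})}$; - $(0,1)$: $A_i=\frac{\phi_{\xi\xi}(1;z_{0,i})}{\phi_z(1;z_{0,i})}$, $B_j=-\frac{\phi(1;z_{1,j})}{\phi_{\xi z}(1;z_{1,j})}$; - $(1,2)$: $A_i=\frac{\phi_{\xi\xi}(1;z_{1,i})}{\phi_{\xi z}(1;z_{1,i})}$, $B_j=-\frac{\phi(1;z_{2,j})}{\phi_{\xi\xi z}(1;z_{2,j})}$; - $(2,2)$: $A_i=-\frac{\phi_\xi(1;z_{2,i})}{\phi_{\xi\xi z}(1;z_{2,i})}$, $B_j=-\frac{\phi_\xi(1;z_{2,j})}{\phi_{\xi\xi z}(1;z_{2,j})}$. The pairing $L^2(\mathbb{R},d\alpha)\times L^2(\mathbb{R},d\beta)\to\mathbb{C}$ is $\langle p|q\rangle=\iint\frac{p(x)q(y)}{x+y}\,d\alpha(x)\,d\beta(y)$. *)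

theory Defs
  imports "HOL-Analysis.Analysis" "HOL-Computational_Algebra.Polynomial"
begin

text \<open>
  A discrete cubic string has \<open>n\<close> point masses \<open>g 1, \<dots>, g n\<close> at positions
  \<open>0 < xi 1 < \<dots> < xi n < 1\<close>; only the values of \<open>xi\<close> and \<open>g\<close> on \<open>{1..n}\<close> are used.
\<close>

definition node :: "nat \<Rightarrow> (nat \<Rightarrow> real) \<Rightarrow> nat \<Rightarrow> real" where
  "node n xi i = (if i = 0 then 0 else if i \<le> n then xi i else 1)"

text \<open>
  Differentiation of functions on \<open>[0,1]\<close>, one-sided at the end points. The value is
  meaningless where the function is not differentiable.
\<close>

definition D :: "(real \<Rightarrow> complex) \<Rightarrow> real \<Rightarrow> complex" where
  "D u x = vector_derivative u (at x within {0..1})"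

text \<open>
  \<open>u\<close> satisfies \<open>u''' = c g u\<close> on \<open>(0,1)\<close> in the sense of distributions, where
  \<open>g\<close> stands for the discrete measure of the string and \<open>c\<close> for a complex constant.
  At a mass, \<open>u''\<close> only has one-sided limits.
\<close>

definition cubic_string_solution ::
  "nat \<Rightarrow> (nat \<Rightarrow> real) \<Rightarrow> (nat \<Rightarrow> real) \<Rightarrow> complex \<Rightarrow> (real \<Rightarrow> complex) \<Rightarrow> bool" where
  "cubic_string_solution n xi g c u \<longleftrightarrow>
     (\<forall>x\<in>{0..1}. u differentiable (at x within {0..1})) \<and>
     continuous_on {0..1} (D u) \<and>
     (\<forall>i\<le>n. \<exists>c0 c1 c2. \<forall>x\<in>{node n xi i..node n xi (Suc i)}.
        u x = c0 + c1 * of_real x + c2 * (of_real x)\<^sup>2) \<and>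
     (\<forall>i\<in>{1..n}. \<exists>l r.
        (D (D u) \<longlongrightarrow> l) (at_left (xi i)) \<and>
        (D (D u) \<longlongrightarrow> r) (at_right (xi i)) \<and>
        r - l = c * of_real (g i) * u (xi i))"

text \<open>
  The two initial value problems determine their solutions on \<open>[0,1]\<close>, and only the
  values there are used below, so the choice operator merely fixes values outside.
\<close>

definition phi :: "nat \<Rightarrow> (nat \<Rightarrow> real) \<Rightarrow> (nat \<Rightarrow> real) \<Rightarrow> complex \<Rightarrow> real \<Rightarrow> complex" where
  "phi n xi g z = (SOME u. cubic_string_solution n xi g (- z) u \<and>
     u 0 = 0 \<and> D u 0 = 0 \<and> D (D u) 0 = 1)"

text \<open>
  The three end conditions of Type \<open>a = 0, 1, 2\<close>: the derivative of order \<open>2 - a\<close>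
  is \<open>1\<close> at \<open>1\<close>, and the other two derivatives of order at most \<open>2\<close> vanish there.
\<close>

definition phi_star ::
  "nat \<Rightarrow> (nat \<Rightarrow> real) \<Rightarrow> (nat \<Rightarrow> real) \<Rightarrow> nat \<Rightarrow> complex \<Rightarrow> real \<Rightarrow> complex" where
  "phi_star n xi g a z = (SOME u. cubic_string_solution n xi g z u \<and>
     u 1 = (if a = 2 then 1 else 0) \<and>
     D u 1 = (if a = 1 then 1 else 0) \<and>
     D (D u) 1 = (if a = 0 then 1 else 0))"

text \<open>The derivative of \<open>\<phi>(\<xi>; z)\<close> of order \<open>k\<close> in \<open>\<xi>\<close> at \<open>\<xi> = 1\<close>, as a function of \<open>z\<close>.\<close>

definition phi_end :: "nat \<Rightarrow> (nat \<Rightarrow> real) \<Rightarrow> (nat \<Rightarrow> real) \<Rightarrow> nat \<Rightarrow> complex \<Rightarrow> complex" where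
  "phi_end n xi g k z = (D ^^ k) (phi n xi g z) 1"

definition string_spectrum ::
  "nat \<Rightarrow> (nat \<Rightarrow> real) \<Rightarrow> (nat \<Rightarrow> real) \<Rightarrow> nat \<Rightarrow> complex set" where
  "string_spectrum n xi g a = {z. phi_end n xi g a z = 0}"

definition mass_inner ::
  "nat \<Rightarrow> (nat \<Rightarrow> real) \<Rightarrow> (nat \<Rightarrow> real) \<Rightarrow> (real \<Rightarrow> complex) \<Rightarrow> (real \<Rightarrow> complex) \<Rightarrow> complex" where
  "mass_inner n xi g f h = (\<Sum>i=1..n. of_real (g i) * f (xi i) * h (xi i))"

definition fourier_transform ::
  "nat \<Rightarrow> (nat \<Rightarrow> real) \<Rightarrow> (nat \<Rightarrow> real) \<Rightarrow> nat \<Rightarrow> (real \<Rightarrow> complex) \<Rightarrow> complex \<Rightarrow> complex" where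
  "fourier_transform n xi g a f z = (- 1) ^ a * mass_inner n xi g (phi_star n xi g a z) f"

text \<open>
  The point masses \<open>A\<close> and \<open>B\<close> of the measures \<open>d\<alpha>\<close> and \<open>d\<beta>\<close> attached to the pair
  \<open>(a, b)\<close>; the final \<open>0\<close> concerns only pairs to which no measures are attached.
\<close>

definition alpha_weight ::
  "nat \<Rightarrow> (nat \<Rightarrow> real) \<Rightarrow> (nat \<Rightarrow> real) \<Rightarrow> nat \<times> nat \<Rightarrow> complex \<Rightarrow> complex" where
  "alpha_weight n xi g ab z =
     (let F = phi_end n xi g in
      if ab = (0, 0) then F 1 z / deriv (F 0) z
      else if ab = (0, 1) then F 2 z / deriv (F 0) z
      else if ab = (1, 2) then F 2 z / deriv (F 1) z
      else if ab = (2, 2) then - (F 1 z / deriv (F 2) z)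
      else 0)"

definition beta_weight ::
  "nat \<Rightarrow> (nat \<Rightarrow> real) \<Rightarrow> (nat \<Rightarrow> real) \<Rightarrow> nat \<times> nat \<Rightarrow> complex \<Rightarrow> complex" where
  "beta_weight n xi g ab z =
     (let F = phi_end n xi g in
      if ab = (0, 0) then F 1 z / deriv (F 0) z
      else if ab = (0, 1) then - (F 0 z / deriv (F 1) z)
      else if ab = (1, 2) then - (F 0 z / deriv (F 2) z)
      else if ab = (2, 2) then - (F 1 z / deriv (F 2) z)
      else 0)"

text \<open>
  The integral of \<open>f\<close> against the discrete measure with mass \<open>w z\<close> at each point \<open>z\<close> of
  the finite set \<open>S\<close>. The points and masses are kept complex, so that neither the
  reality of the spectra nor the positivity of the masses is built into the definition.
\<close>

definition atomic_integral ::
  "complex set \<Rightarrow> (complex \<Rightarrow> complex) \<Rightarrow> (complex \<Rightarrow> complex) \<Rightarrow> complex" where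
  "atomic_integral S w f = (\<Sum>z\<in>S. w z * f z)"

definition cauchy_pairing ::
  "nat \<Rightarrow> (nat \<Rightarrow> real) \<Rightarrow> (nat \<Rightarrow> real) \<Rightarrow> nat \<times> nat \<Rightarrow>
   (complex \<Rightarrow> complex) \<Rightarrow> (complex \<Rightarrow> complex) \<Rightarrow> complex" where
  "cauchy_pairing n xi g ab p q =
     atomic_integral (string_spectrum n xi g (fst ab)) (alpha_weight n xi g ab) (\<lambda>x.
       atomic_integral (string_spectrum n xi g (snd ab)) (beta_weight n xi g ab) (\<lambda>y.
         p x * q y / (x + y)))"

definition chi :: "nat \<Rightarrow> (nat \<Rightarrow> real) \<Rightarrow> real \<Rightarrow> nat \<Rightarrow> real \<Rightarrow> complex" where
  "chi n xi eps j = indicator {xi (n - j) - eps <..< xi (n - j) + eps}"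

end

theory Submission
  imports Defs "HOL-Computational_Algebra.Fundamental_Theorem_Algebra"
    "Jordan_Normal_Form.Determinant"
begin

text \<open>
  Write \<open>\<psi>\<^sub>a = (- 1)\<^sup>a \<phi>\<^sub>a\<^sup>*\<close> and \<open>F\<^sub>k(z)\<close> for the \<open>k\<close>-th derivative of \<open>\<phi>(\<cdot>; z)\<close> at \<open>1\<close>.
  The Lagrange identity gives
  \<open>F\<^sub>a(z) - F\<^sub>a(w) = (w - z) (\<phi>(\<cdot>; z), \<psi>\<^sub>a(\<cdot>; w))\<^sub>g\<close>, so on the spectrum of Type \<open>a\<close> the two families
  are biorthogonal, the diagonal terms being \<open>- F\<^sub>a'\<close>. As the spectrum consists of \<open>n\<close> simple zeros,
  they are also complete. The same identity for two copies of \<open>\<phi>\<close> gives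
  \<open>(x + y) (\<phi>(\<cdot>; x), \<phi>(\<cdot>; y))\<^sub>g = F\<^sub>1(x) F\<^sub>1(y) - F\<^sub>2(x) F\<^sub>0(y) - F\<^sub>0(x) F\<^sub>2(y)\<close>, and for \<open>x\<close>, \<open>y\<close> in the
  two spectra only one product on the right survives. Hence the coefficients of \<open>\<phi>(\<cdot>; x)\<close> in the
  eigenbasis of Type \<open>b\<close> are Cauchy kernels weighted by \<open>A\<close> and \<open>B\<close>, which turns the pairing of the
  transforms of \<open>\<chi>\<^sub>i\<close> and \<open>\<chi>\<^sub>j\<close> into the completeness relation.

  The zeros of \<open>F\<^sub>0\<close>, \<open>F\<^sub>1\<close>, \<open>F\<^sub>2\<close> are real, simple and positive because the Bezoutians of
  \<open>F\<^sub>i\<close>, \<open>F\<^sub>j\<close> and of \<open>z F\<^sub>i\<close>, \<open>F\<^sub>j\<close> for \<open>i < j\<close> stay positive as one passes from mass to mass.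
\<close>

section \<open>Linear algebra and root counting\<close>

text \<open>Since \<open>S\<close> and \<open>K\<close> have equal size, \<open>a\<close> and
  \<open>b\<close> are square matrices, and a one-sided inverse is two-sided. This is what turns
  biorthogonality into completeness.\<close>

lemma dual_system_swap:
  fixes a b :: "'i \<Rightarrow> 'k \<Rightarrow> 'a :: field"
  assumes "finite S" "finite K" "card S = card K"
    and dual: "\<And>x y. x \<in> S \<Longrightarrow> y \<in> S \<Longrightarrow> (\<Sum>k\<in>K. a x k * b y k) = (if x = y then 1 else 0)"
    and "k \<in> K" "l \<in> K"
  shows "(\<Sum>x\<in>S. a x k * b x l) = (if k = l then 1 else 0)"
proof -
  define N where "N = card S"
  obtain s where s: "bij_betw s {0..<N} S"
    using ex_bij_betw_nat_finite[OF assms(1)] N_def by auto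
  obtain t where t: "bij_betw t {0..<N} K"
    using ex_bij_betw_nat_finite[OF assms(2)] assms(3) N_def by auto
  define A where "A = mat N N (\<lambda>(i, j). a (s i) (t j))"
  define B where "B = mat N N (\<lambda>(j, i). b (s i) (t j))"
  have sS: "s i \<in> S" if "i < N" for i
    using s that by (auto simp: bij_betw_def)
  have inj: "s i = s j \<longleftrightarrow> i = j" if "i < N" "j < N" for i j
    using s that by (auto simp: bij_betw_def inj_on_def)
  have injt: "t i = t j \<longleftrightarrow> i = j" if "i < N" "j < N" for i j
    using t that by (auto simp: bij_betw_def inj_on_def)
  have "A * B = 1\<^sub>m N"
  proof (rule eq_matI)
    fix i j assume "i < dim_row (1\<^sub>m N :: 'a mat)" "j < dim_col (1\<^sub>m N :: 'a mat)"
    then have ij: "i < N" "j < N" by auto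
    have "(A * B) $$ (i, j) = (\<Sum>m = 0..<N. a (s i) (t m) * b (s j) (t m))"
      using ij by (simp add: A_def B_def scalar_prod_def)
    also have "\<dots> = (\<Sum>k\<in>K. a (s i) k * b (s j) k)"
      using t by (rule sum.reindex_bij_betw)
    finally show "(A * B) $$ (i, j) = 1\<^sub>m N $$ (i, j)"
      using dual[OF sS sS] ij inj by simp
  qed (auto simp: A_def B_def)
  then have BA: "B * A = 1\<^sub>m N"
    by (intro mat_mult_left_right_inverse[where A = A]) (auto simp: A_def B_def)
  obtain i j where ij: "i < N" "t i = l" "j < N" "t j = k"
    using t assms(5,6) unfolding bij_betw_def by (metis atLeastLessThan_iff imageE)
  have "(\<Sum>x\<in>S. a x k * b x l) = (\<Sum>m = 0..<N. a (s m) k * b (s m) l)"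
    using s by (rule sum.reindex_bij_betw[symmetric])
  also have "\<dots> = (B * A) $$ (i, j)"
    using ij by (simp add: A_def B_def scalar_prod_def mult.commute)
  finally show ?thesis
    using ij injt BA by auto
qed

text \<open>Over the complex numbers the degree counts the roots with multiplicity, and simplicity
  makes every multiplicity one.\<close>

lemma card_simple_roots:
  fixes p :: "complex poly"
  assumes "p \<noteq> 0" and simple: "\<And>z. poly p z = 0 \<Longrightarrow> poly (pderiv p) z \<noteq> 0"
  shows "card {z. poly p z = 0} = degree p"
proof -
  have sq: "rsquarefree p"
    using simple by (auto simp: rsquarefree_roots)
  have "degree p = size (proots p)"
    by (simp add: size_proots_complex)
  also have "\<dots> = (\<Sum>z\<in>{z. poly p z = 0}. Polynomial.order z p)"
    using assms(1) by (simp add: size_multiset_overloaded_eq)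
  also have "\<dots> = (\<Sum>z\<in>{z. poly p z = 0}. 1)"
    using sq assms(1) by (intro sum.cong) (auto simp: rsquarefree_root_order)
  finally show ?thesis by simp
qed

section \<open>Discrete data of a solution\<close>

text \<open>
  \<open>a i\<close>, \<open>b i\<close> are the value and slope at node \<open>i\<close>, and \<open>c i\<close> is the second derivative between the
  nodes \<open>i\<close> and \<open>Suc i\<close>, which are \<open>h i\<close> apart.
\<close>

definition string_data ::
  "nat \<Rightarrow> (nat \<Rightarrow> real) \<Rightarrow> (nat \<Rightarrow> real) \<Rightarrow> complex \<Rightarrow>
   (nat \<Rightarrow> complex) \<Rightarrow> (nat \<Rightarrow> complex) \<Rightarrow> (nat \<Rightarrow> complex) \<Rightarrow> bool" where
  "string_data n h g \<kappa> a b c \<longleftrightarrow>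
     (\<forall>i\<le>n. a (Suc i) = a i + of_real (h i) * b i + (of_real (h i))\<^sup>2 / 2 * c i \<and>
            b (Suc i) = b i + of_real (h i) * c i) \<and>
     (\<forall>i<n. c (Suc i) = c i + \<kappa> * of_real (g (Suc i)) * a (Suc i))"

text \<open>This is the reflection of \<open>[0,1]\<close>: slopes and the jumps of the second
  derivative change sign, hence \<open>- b\<close> and \<open>- \<kappa>\<close>. Nodes reflect by
  \<open>Suc n - i\<close> but gaps, which carry \<open>c\<close>, by \<open>n - i\<close>.\<close>

lemma string_data_reverse:
  assumes "string_data n (\<lambda>i. h (n - i)) (\<lambda>i. g (Suc n - i)) (- \<kappa>) a b c"
  shows "string_data n h g \<kappa> (\<lambda>i. a (Suc n - i)) (\<lambda>i. - b (Suc n - i)) (\<lambda>i. c (n - i))"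
  unfolding string_data_def
proof (intro conjI allI impI)
  fix i assume "i \<le> n"
  then have e: "Suc n - i = Suc (n - i)" "Suc n - Suc i = n - i" "n - (n - i) = i"
    by auto
  have b': "b (Suc (n - i)) = b (n - i) + of_real (h i) * c (n - i)"
    and a': "a (Suc (n - i)) = a (n - i) + of_real (h i) * b (n - i) + (of_real (h i))\<^sup>2 / 2 * c (n - i)"
    using assms e unfolding string_data_def by (metis diff_le_self)+
  show "a (Suc n - Suc i) = a (Suc n - i) + of_real (h i) * - b (Suc n - i)
          + (of_real (h i))\<^sup>2 / 2 * c (n - i)"
    "- b (Suc n - Suc i) = - b (Suc n - i) + of_real (h i) * c (n - i)"
    unfolding e a' b' by (simp_all add: algebra_simps power2_eq_square)
next
  fix i assume i: "i < n"
  then have e: "Suc (n - Suc i) = n - i" "Suc n - (n - i) = Suc i" "n - Suc i < n" "Suc n - Suc i = n - i"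
    by auto
  have "c (Suc (n - Suc i)) = c (n - Suc i)
      + - \<kappa> * of_real (g (Suc n - Suc (n - Suc i))) * a (Suc (n - Suc i))"
    using assms e(3) unfolding string_data_def by blast
  then show "c (n - Suc i) = c (n - i) + \<kappa> * of_real (g (Suc i)) * a (Suc n - Suc i)"
    unfolding e by simp
qed

lemma string_data_scale:
  assumes "string_data n h g \<kappa> a b c"
  shows "string_data n h g \<kappa> (\<lambda>i. t * a i) (\<lambda>i. t * b i) (\<lambda>i. t * c i)"
  using assms by (auto simp: string_data_def algebra_simps)

lemma string_data_unique:
  assumes "string_data n h g \<kappa> a b c" "string_data n h g \<kappa> a' b' c'"
    and "a 0 = a' 0" "b 0 = b' 0" "c 0 = c' 0"
  shows "i \<le> Suc n \<Longrightarrow> a i = a' i" "i \<le> Suc n \<Longrightarrow> b i = b' i" "i \<le> n \<Longrightarrow> c i = c' i"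
proof -
  have "i \<le> Suc n \<longrightarrow> a i = a' i \<and> b i = b' i \<and> (i \<le> n \<longrightarrow> c i = c' i)"
  proof (induction i)
    case (Suc i)
    show ?case
    proof
      assume i: "Suc i \<le> Suc n"
      with Suc have *: "a i = a' i" "b i = b' i" "c i = c' i" by auto
      have ab: "a (Suc i) = a' (Suc i)" "b (Suc i) = b' (Suc i)"
        using assms(1,2) i unfolding string_data_def by (simp_all add: *)
      then show "a (Suc i) = a' (Suc i) \<and> b (Suc i) = b' (Suc i) \<and>
          (Suc i \<le> n \<longrightarrow> c (Suc i) = c' (Suc i))"
        using assms(1,2) i * unfolding string_data_def by (auto simp: Suc_le_eq)
    qed
  qed (use assms in auto)
  then show "i \<le> Suc n \<Longrightarrow> a i = a' i" "i \<le> Suc n \<Longrightarrow> b i = b' i" "i \<le> n \<Longrightarrow> c i = c' i"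
    by auto
qed

text \<open>Reflection turns the data at the right end into initial data, where forward uniqueness
  applies.\<close>

lemma string_data_unique_right:
  assumes A: "string_data n h g \<kappa> a b c" and B: "string_data n h g \<kappa> a' b' c'"
    and "a (Suc n) = a' (Suc n)" "b (Suc n) = b' (Suc n)" "c n = c' n"
    and "i \<le> Suc n"
  shows "a i = a' i"
proof -
  have R: "string_data n (\<lambda>i. h (n - i)) (\<lambda>i. g (Suc n - i)) (- \<kappa>)
      (\<lambda>i. a (Suc n - i)) (\<lambda>i. - b (Suc n - i)) (\<lambda>i. c (n - i))"
    if "string_data n h g \<kappa> a b c" for a b c
  proof (rule string_data_reverse)
    \<comment> \<open>Reflecting twice restores the string only at the indices that
      \<open>string_data\<close> reads, hence the unfolding.\<close>
    show "string_data n (\<lambda>i. h (n - (n - i))) (\<lambda>i. g (Suc n - (Suc n - i))) (- (- \<kappa>)) a b c"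
      using that unfolding string_data_def by (auto simp: le_simps)
  qed
  have "a (Suc n - (Suc n - i)) = a' (Suc n - (Suc n - i))"
    by (rule string_data_unique(1)[OF R[OF A] R[OF B]]) (use assms in auto)
  then show ?thesis using assms(6) by simp
qed

text \<open>The form \<open>u'' v - u' v' + u v''\<close> has derivative
  \<open>u''' v + u v'''\<close>. It is therefore constant on gaps and jumps at mass
  \<open>i\<close> by \<open>(\<kappa> + \<kappa>') g i u v\<close>; the jumps telescope.\<close>

lemma string_data_Lagrange:
  assumes "string_data n h g \<kappa> a b c" "string_data n h g \<kappa>' a' b' c'"
  shows "(c n * a' (Suc n) - b (Suc n) * b' (Suc n) + a (Suc n) * c' n)
      - (c 0 * a' 0 - b 0 * b' 0 + a 0 * c' 0)
    = (\<kappa> + \<kappa>') * (\<Sum>i=1..n. of_real (g i) * a i * a' i)"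
proof -
  have gap: "c i * a' (Suc i) - b (Suc i) * b' (Suc i) + a (Suc i) * c' i
      = c i * a' i - b i * b' i + a i * c' i" if "i \<le> n" for i
    using assms that unfolding string_data_def
    by (simp add: algebra_simps power2_eq_square)
  have "m \<le> n \<Longrightarrow> (c m * a' m - b m * b' m + a m * c' m)
      - (c 0 * a' 0 - b 0 * b' 0 + a 0 * c' 0)
    = (\<kappa> + \<kappa>') * (\<Sum>i=1..m. of_real (g i) * a i * a' i)" for m
  proof (induction m)
    case (Suc m)
    then have IH: "(c m * a' m - b m * b' m + a m * c' m)
      = (\<kappa> + \<kappa>') * (\<Sum>i=1..m. of_real (g i) * a i * a' i) + (c 0 * a' 0 - b 0 * b' 0 + a 0 * c' 0)"
      by (simp add: algebra_simps)
    have c: "c (Suc m) = c m + \<kappa> * of_real (g (Suc m)) * a (Suc m)"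
      "c' (Suc m) = c' m + \<kappa>' * of_real (g (Suc m)) * a' (Suc m)"
      using assms Suc.prems unfolding string_data_def by auto
    have "c (Suc m) * a' (Suc m) - b (Suc m) * b' (Suc m) + a (Suc m) * c' (Suc m)
       = (c m * a' (Suc m) - b (Suc m) * b' (Suc m) + a (Suc m) * c' m)
         + (\<kappa> + \<kappa>') * (of_real (g (Suc m)) * a (Suc m) * a' (Suc m))"
      unfolding c by (simp add: algebra_simps)
    also have "c m * a' (Suc m) - b (Suc m) * b' (Suc m) + a (Suc m) * c' m
       = c m * a' m - b m * b' m + a m * c' m"
      using gap[of m] Suc.prems by simp
    finally show ?case
      unfolding IH by (simp add: distrib_left)
  qed simp
  from this[of n] gap[of n] show ?thesis by simp
qed

section \<open>Solutions as polynomials in the spectral parameter\<close>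

text \<open>The recursion of \<open>string_data\<close> with \<open>\<kappa> = - z\<close>, carried
  out on polynomials in \<open>z\<close>; \<open>pCons 0\<close> is multiplication by
  \<open>z\<close>.\<close>

primrec chain ::
  "(nat \<Rightarrow> real) \<Rightarrow> (nat \<Rightarrow> real) \<Rightarrow> complex poly \<times> complex poly \<times> complex poly \<Rightarrow>
   nat \<Rightarrow> complex poly \<times> complex poly \<times> complex poly" where
  "chain h g s 0 = s"
| "chain h g s (Suc i) =
     (case chain h g s i of (a, b, c) \<Rightarrow>
       let a' = a + Polynomial.smult (of_real (h i)) b + Polynomial.smult (of_real ((h i)\<^sup>2 / 2)) c in
       (a', b + Polynomial.smult (of_real (h i)) c, c - Polynomial.smult (of_real (g (Suc i))) (pCons 0 a')))"

abbreviation chain_val where "chain_val h g s i \<equiv> fst (chain h g s i)"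
abbreviation chain_slope where "chain_slope h g s i \<equiv> fst (snd (chain h g s i))"
abbreviation chain_curv where "chain_curv h g s i \<equiv> snd (snd (chain h g s i))"

lemma chain_Suc:
  "chain_val h g s (Suc i) = chain_val h g s i + Polynomial.smult (of_real (h i)) (chain_slope h g s i)
     + Polynomial.smult (of_real ((h i)\<^sup>2 / 2)) (chain_curv h g s i)"
  "chain_slope h g s (Suc i) = chain_slope h g s i + Polynomial.smult (of_real (h i)) (chain_curv h g s i)"
  "chain_curv h g s (Suc i) = chain_curv h g s i
     - Polynomial.smult (of_real (g (Suc i))) (pCons 0 (chain_val h g s (Suc i)))"
  by (simp_all add: Let_def split: prod.splits)

lemma string_data_chain:
  "string_data n h g (- z) (\<lambda>i. poly (chain_val h g s i) z)
     (\<lambda>i. poly (chain_slope h g s i) z) (\<lambda>i. poly (chain_curv h g s i) z)"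
  unfolding string_data_def
  by (simp only: chain_Suc) (auto simp: power2_eq_square)

text \<open>A mass feeds \<open>z\<close> times the current value into the curvature, which then has
  the strictly highest degree and dominates the next value. So each mass crossed raises the degree
  by exactly one.\<close>

lemma degree_chain_val:
  assumes h: "\<And>i. i \<le> n \<Longrightarrow> h i > 0" and g: "\<And>i. i \<in> {1..n} \<Longrightarrow> g i > 0"
    and s: "s = ([:of_real r0:], [:of_real r1:], [:of_real r2:])"
    and r: "r0 \<ge> 0" "r1 \<ge> 0" "r2 \<ge> 0" "r0 + r1 + r2 > 0"
    and "m \<le> n"
  shows "degree (chain_val h g s (Suc m)) = m"
proof -
  have "m \<le> n \<Longrightarrow> chain_val h g s (Suc m) \<noteq> 0 \<and> degree (chain_val h g s (Suc m)) = m
     \<and> degree (chain_slope h g s (Suc m)) \<le> m \<and> degree (chain_curv h g s m) \<le> m" for m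
  proof (induction m)
    case 0
    \<comment> \<open>The first value is a constant polynomial; nonnegative starting data that are
      not all zero keep it from vanishing.\<close>
    have "r0 + h 0 * r1 + (h 0)\<^sup>2 / 2 * r2 > 0"
    proof -
      have "h 0 > 0" using h by simp
      then have "h 0 * r1 \<ge> 0" "(h 0)\<^sup>2 / 2 * r2 \<ge> 0"
        "r1 > 0 \<Longrightarrow> h 0 * r1 > 0" "r2 > 0 \<Longrightarrow> (h 0)\<^sup>2 / 2 * r2 > 0"
        using r by auto
      then show ?thesis using r by linarith
    qed
    then have "complex_of_real (r0 + h 0 * r1 + (h 0)\<^sup>2 / 2 * r2) \<noteq> 0"
      unfolding of_real_eq_0_iff by simp
    then show ?case by (simp add: s)
  next
    case (Suc m)
    define A where "A = chain_val h g s (Suc m)"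
    define G where "G = Polynomial.smult (complex_of_real (g (Suc m))) (pCons 0 A)"
    have A: "A \<noteq> 0" "degree A = m" "degree (chain_slope h g s (Suc m)) \<le> m"
        "degree (chain_curv h g s m) \<le> m"
      using Suc by (auto simp: A_def)
    have G: "degree G = Suc m"
      using A g[of "Suc m"] Suc.prems by (simp add: G_def)
    have c: "chain_curv h g s (Suc m) = - G + chain_curv h g s m"
      by (simp only: chain_Suc G_def A_def) simp
    have dc: "degree (chain_curv h g s (Suc m)) = Suc m"
      unfolding c by (subst degree_add_eq_left) (use A G in auto)
    have hs: "h (Suc m) > 0" using h Suc.prems by simp
    have "chain_val h g s (Suc (Suc m)) = Polynomial.smult (of_real ((h (Suc m))\<^sup>2 / 2)) (chain_curv h g s (Suc m))
        + (A + Polynomial.smult (of_real (h (Suc m))) (chain_slope h g s (Suc m)))"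
      by (subst chain_Suc(1)) (simp add: A_def del: chain.simps)
    moreover have "degree \<dots> = Suc m"
    proof (subst degree_add_eq_left)
      have "degree (A + Polynomial.smult (of_real (h (Suc m))) (chain_slope h g s (Suc m))) \<le> m"
        by (intro degree_add_le) (use A hs in auto)
      also have "m < degree (Polynomial.smult (complex_of_real ((h (Suc m))\<^sup>2 / 2)) (chain_curv h g s (Suc m)))"
        using hs dc by simp
      finally show "degree (A + Polynomial.smult (of_real (h (Suc m))) (chain_slope h g s (Suc m)))
        < degree (Polynomial.smult (complex_of_real ((h (Suc m))\<^sup>2 / 2)) (chain_curv h g s (Suc m)))" .
    qed (use hs dc in simp)
    ultimately have v: "degree (chain_val h g s (Suc (Suc m))) = Suc m" by simp
    moreover have "degree (chain_slope h g s (Suc (Suc m))) \<le> Suc m"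
      unfolding chain_Suc(2)[of h g s "Suc m"]
      by (intro degree_add_le) (use A hs dc in auto)
    ultimately show ?case
      using dc by (metis degree_0 nat.simps(3) order_refl)
  qed
  with \<open>m \<le> n\<close> show ?thesis by blast
qed

section \<open>Simplicity and positivity of the spectra\<close>

text \<open>
  A pair \<open>(r, d)\<close> stands for \<open>r + d Y\<close> in \<open>\<real>[Y] / (Y\<^sup>2 = - \<sigma>)\<close> and \<open>x + Y\<close> for the spectral
  parameter. With \<open>\<sigma> = (Im z)\<^sup>2 > 0\<close> this encodes values at \<open>z\<close>, so that non-real zeros are excluded;
  with \<open>\<sigma> = 0\<close> it encodes values and derivatives at a real point, so that multiple zeros are excluded.
  Then \<open>bezZ x \<sigma> p q = bez ((x + Y) p) q\<close>.
\<close>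

definition bez :: "real \<times> real \<Rightarrow> real \<times> real \<Rightarrow> real" where
  "bez p q = snd p * fst q - fst p * snd q"

definition bezZ :: "real \<Rightarrow> real \<Rightarrow> real \<times> real \<Rightarrow> real \<times> real \<Rightarrow> real" where
  "bezZ x \<sigma> p q = fst p * fst q + \<sigma> * (snd p * snd q) + x * bez p q"

text \<open>Before the first mass the three polynomials are constants, so their plain Bezoutians
  vanish while the shifted ones are already positive. Hence the mixture of weak and strict
  inequalities.\<close>

definition interlacing :: "real \<Rightarrow> real \<Rightarrow> real \<times> real \<Rightarrow> real \<times> real \<Rightarrow> real \<times> real \<Rightarrow> bool" where
  "interlacing x \<sigma> a b c \<longleftrightarrow> bez a b \<ge> 0 \<and> bez a c \<ge> 0 \<and> bez b c \<ge> 0 \<and>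
     bezZ x \<sigma> a b > 0 \<and> bezZ x \<sigma> a c > 0 \<and> bezZ x \<sigma> b c > 0"

text \<open>Crossing a mass replaces \<open>c\<close> by \<open>c - g (x + Y) a\<close>, and the
  following gap then updates \<open>b\<close> and \<open>a\<close>. By bilinearity every new
  Bezoutian is a combination of old ones and of squared norms \<open>M\<close> with nonnegative
  coefficients. The summand \<open>g * bezZ x \<sigma> a b\<close> makes the plain ones
  strict.\<close>

lemma interlacing_step:
  assumes I: "interlacing x \<sigma> a b c" and "\<sigma> \<ge> 0" "g > 0" "h > 0"
    and c': "c' = (fst c - g * (x * fst a - \<sigma> * snd a), snd c - g * (x * snd a + fst a))"
    and b': "b' = (fst b + h * fst c', snd b + h * snd c')"
    and a': "a' = (fst a + h * fst b + h\<^sup>2 / 2 * fst c', snd a + h * snd b + h\<^sup>2 / 2 * snd c')"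
  shows "interlacing x \<sigma> a' b' c'" "bez a' b' > 0" "bez a' c' > 0" "bez b' c' > 0"
proof -
  define M where "M = (\<lambda>p :: real \<times> real. (fst p)\<^sup>2 + \<sigma> * (snd p)\<^sup>2)"
  have M: "M p \<ge> 0" for p using assms(2) by (simp add: M_def)
  note defs = bez_def bezZ_def M_def algebra_simps power2_eq_square
  have 1: "bez b c' = bez b c + g * bezZ x \<sigma> a b"
    by (simp add: c' defs)
  have 2: "bez a c' = bez a c + g * M a"
    by (simp add: c' defs)
  have 3: "bezZ x \<sigma> b c' = bezZ x \<sigma> b c + (x\<^sup>2 + \<sigma>) * g * bez a b"
    by (simp add: c' defs)
  have 4: "bezZ x \<sigma> a c' = bezZ x \<sigma> a c"
    by (simp add: c' defs)
  have 5: "bez a' c' = bez a c' + h * bez b c'" "bez b' c' = bez b c'"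
    by (simp_all add: a' b' defs)
  have 6: "bez a' b' = bez a b + h * bez a c' + h\<^sup>2 / 2 * bez b c'"
    by (simp add: a' b' defs) (simp add: field_simps)
  have 7: "bezZ x \<sigma> b' c' = bezZ x \<sigma> b c' + h * M c'"
    by (simp add: b' defs)
  have 8: "bezZ x \<sigma> a' c' = bezZ x \<sigma> a c' + h * bezZ x \<sigma> b c' + h\<^sup>2 / 2 * M c'"
    by (simp add: a' defs)
  \<comment> \<open>As \<open>bezZ\<close> is not antisymmetric, expansion leaves a product of
    \<open>b\<close> and \<open>c'\<close> of no definite sign; it is absorbed into the square
    \<open>M b'\<close>.\<close>
  have 9: "bezZ x \<sigma> a' b' = bezZ x \<sigma> a b + h * bezZ x \<sigma> a c'
      + h / 2 * (M b + h * bezZ x \<sigma> b c' + M b')"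
    by (simp add: a' b' defs) (simp add: field_simps)
  note pos = assms(2-4)
  have ab: "bez a b \<ge> 0" "bez a c \<ge> 0" "bez b c \<ge> 0"
      "bezZ x \<sigma> a b > 0" "bezZ x \<sigma> a c > 0" "bezZ x \<sigma> b c > 0"
    using I by (auto simp: interlacing_def)
  have p1: "bez b c' > 0"
    unfolding 1 using ab pos by (intro add_nonneg_pos) auto
  have p2: "bez a c' \<ge> 0"
    unfolding 2 using ab pos M by (intro add_nonneg_nonneg) auto
  have p3: "bezZ x \<sigma> b c' > 0"
    unfolding 3 using ab pos by (intro add_pos_nonneg) auto
  have p4: "bezZ x \<sigma> a c' > 0"
    unfolding 4 using ab by simp
  show p5: "bez a' c' > 0" "bez b' c' > 0"
    unfolding 5 using p1 p2 pos by (auto intro!: add_nonneg_pos)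
  show p6: "bez a' b' > 0"
    unfolding 6 using p1 p2 ab pos by (intro add_nonneg_pos add_nonneg_nonneg) auto
  have p7: "bezZ x \<sigma> b' c' > 0"
    unfolding 7 using p3 M[of c'] pos by (intro add_pos_nonneg) auto
  have p8: "bezZ x \<sigma> a' c' > 0"
    unfolding 8 using p3 p4 M[of c'] pos by (intro add_pos_nonneg) auto
  have p9: "bezZ x \<sigma> a' b' > 0"
    unfolding 9 using p3 p4 ab M[of b] M[of b'] pos by (intro add_pos_nonneg) auto
  show "interlacing x \<sigma> a' b' c'"
    using p5 p6 p7 p8 p9 by (simp add: interlacing_def)
qed

text \<open>Off the real axis \<open>Y\<close> is \<open>i\<close> times \<open>Im z\<close>, and
  dividing by \<open>Im z\<close> reads off the coefficient of \<open>Y\<close>. On it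
  \<open>Y\<close> is a dual number, whose coefficient is the derivative.\<close>

definition jet :: "complex \<Rightarrow> complex poly \<Rightarrow> real \<times> real" where
  "jet z p = (Re (poly p z),
     if Im z = 0 then Re (poly (pderiv p) z) else Im (poly p z) / Im z)"

lemma jet_add: "jet z (p + q) = jet z p + jet z q"
  by (simp add: jet_def pderiv_add add_divide_distrib)

lemma jet_diff: "jet z (p - q) = jet z p - jet z q"
  by (simp add: jet_def pderiv_diff diff_divide_distrib)

lemma jet_smult: "jet z (Polynomial.smult (of_real t) p) = (t * fst (jet z p), t * snd (jet z p))"
  by (simp add: jet_def pderiv_smult)

lemma jet_pCons:
  "jet z (pCons 0 p) = (Re z * fst (jet z p) - (Im z)\<^sup>2 * snd (jet z p), Re z * snd (jet z p) + fst (jet z p))"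
  by (simp add: jet_def pderiv_pCons power2_eq_square field_simps)

text \<open>Induction over the masses, starting from the constants on the first gap. The strict
  plain Bezoutians come from the last mass crossed, so at least one mass is required.\<close>

lemma interlacing_chain:
  fixes z :: complex
  assumes h: "\<And>i. i \<le> n \<Longrightarrow> h i > 0" and g: "\<And>i. i \<in> {1..n} \<Longrightarrow> g i > 0" and "n \<ge> 1"
  defines "F0 \<equiv> jet z (chain_val h g (0, 0, 1) (Suc n))"
    and "F1 \<equiv> jet z (chain_slope h g (0, 0, 1) (Suc n))"
    and "F2 \<equiv> jet z (chain_curv h g (0, 0, 1) n)"
  shows "interlacing (Re z) ((Im z)\<^sup>2) F0 F1 F2 \<and> bez F0 F1 > 0 \<and> bez F0 F2 > 0 \<and> bez F1 F2 > 0"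
proof -
  let ?s = "(0, 0, 1) :: complex poly \<times> complex poly \<times> complex poly"
  let ?I = "\<lambda>m. interlacing (Re z) ((Im z)\<^sup>2) (jet z (chain_val h g ?s (Suc m)))
      (jet z (chain_slope h g ?s (Suc m))) (jet z (chain_curv h g ?s m))"
  have step: "?I (Suc m) \<and> bez (jet z (chain_val h g ?s (Suc (Suc m)))) (jet z (chain_slope h g ?s (Suc (Suc m)))) > 0
      \<and> bez (jet z (chain_val h g ?s (Suc (Suc m)))) (jet z (chain_curv h g ?s (Suc m))) > 0
      \<and> bez (jet z (chain_slope h g ?s (Suc (Suc m)))) (jet z (chain_curv h g ?s (Suc m))) > 0"
    if I: "?I m" and m: "Suc m \<le> n" for m
  proof -
    have gh: "g (Suc m) > 0" "h (Suc m) > 0" using g h m by auto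
    have c: "jet z (chain_curv h g ?s (Suc m)) =
      (fst (jet z (chain_curv h g ?s m)) - g (Suc m) * (Re z * fst (jet z (chain_val h g ?s (Suc m)))
          - (Im z)\<^sup>2 * snd (jet z (chain_val h g ?s (Suc m)))),
       snd (jet z (chain_curv h g ?s m)) - g (Suc m) * (Re z * snd (jet z (chain_val h g ?s (Suc m)))
          + fst (jet z (chain_val h g ?s (Suc m)))))"
      by (subst chain_Suc(3)) (simp only: jet_diff jet_smult jet_pCons, simp add: prod_eq_iff)
    have b: "jet z (chain_slope h g ?s (Suc (Suc m))) =
      (fst (jet z (chain_slope h g ?s (Suc m))) + h (Suc m) * fst (jet z (chain_curv h g ?s (Suc m))),
       snd (jet z (chain_slope h g ?s (Suc m))) + h (Suc m) * snd (jet z (chain_curv h g ?s (Suc m))))"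
      by (subst chain_Suc(2)) (simp only: jet_add jet_smult, simp add: prod_eq_iff)
    have a: "jet z (chain_val h g ?s (Suc (Suc m))) =
      (fst (jet z (chain_val h g ?s (Suc m))) + h (Suc m) * fst (jet z (chain_slope h g ?s (Suc m)))
         + (h (Suc m))\<^sup>2 / 2 * fst (jet z (chain_curv h g ?s (Suc m))),
       snd (jet z (chain_val h g ?s (Suc m))) + h (Suc m) * snd (jet z (chain_slope h g ?s (Suc m)))
         + (h (Suc m))\<^sup>2 / 2 * snd (jet z (chain_curv h g ?s (Suc m))))"
      by (subst chain_Suc(1)) (simp only: jet_add jet_smult, simp add: prod_eq_iff)
    show ?thesis
      using interlacing_step[OF I _ gh c b a] by simp
  qed
  have "m \<le> n \<Longrightarrow> ?I m" for m
  proof (induction m)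
    case 0
    then show ?case
      using h[of 0] by (simp add: interlacing_def bez_def bezZ_def jet_def pderiv_smult pderiv_1)
  next
    case (Suc m)
    then show ?case using step[of m] by (simp del: chain.simps)
  qed
  note I = this
  obtain m where m: "n = Suc m" using \<open>n \<ge> 1\<close> by (cases n) auto
  then have le: "m \<le> n" "Suc m \<le> n" by auto
  show ?thesis
    using step[OF I[OF le(1)] le(2)] unfolding F0_def F1_def F2_def m .
qed

text \<open>A non-real or a double zero would make the jet vanish, contradicting a strict Bezoutian.
  At a simple real zero \<open>bezZ\<close> reduces to \<open>Re z\<close> times a Bezoutian, and
  both are positive.\<close>

lemma interlacing_root:
  assumes "interlacing (Re z) ((Im z)\<^sup>2) (jet z F0) (jet z F1) (jet z F2)"
    and "bez (jet z F0) (jet z F1) > 0" "bez (jet z F0) (jet z F2) > 0"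
    and "F \<in> {F0, F1, F2}" "poly F z = 0"
  shows "Im z = 0 \<and> Re z > 0 \<and> poly (pderiv F) z \<noteq> 0"
proof -
  have nz: "jet z F \<noteq> (0, 0)"
    using assms by (auto simp: bez_def)
  then have im: "Im z = 0" and d: "poly (pderiv F) z \<noteq> 0"
    using assms(5) by (auto simp: jet_def split: if_splits)
  have r: "fst (jet z F) = 0" using assms(5) by (simp add: jet_def)
  \<comment> \<open>The witness is the Bezoutian of \<open>F\<close> with a partner:
    \<open>F0\<close> for \<open>F2\<close>, and \<open>F0\<close>, \<open>F1\<close> for each
    other.\<close>
  have "\<exists>b>0. Re z * b > 0"
  proof (cases "F = F2")
    case True
    then show ?thesis using assms im r
      by (intro exI[of _ "bez (jet z F0) (jet z F2)"]) (auto simp: interlacing_def bezZ_def)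
  next
    case False
    then show ?thesis using assms im r
      by (intro exI[of _ "bez (jet z F0) (jet z F1)"]) (auto simp: interlacing_def bezZ_def)
  qed
  then show ?thesis
    using im d by (auto simp: zero_less_mult_iff)
qed

section \<open>Solutions of the distributional equation\<close>

text \<open>Truncated squares are C^1 and their second derivative has a single jump, at
  \<open>t\<close>; solutions with prescribed jumps are assembled from them.\<close>

lemma has_vector_derivative_sq_pos_part:
  "((\<lambda>x. complex_of_real ((max 0 (x - t))\<^sup>2)) has_vector_derivative
      of_real (2 * max 0 (x - t))) (at x within S)"
proof -
  have "((\<lambda>x. (max 0 (x - t))\<^sup>2) has_real_derivative 2 * max 0 (x - t)) (at x)"
  proof (cases x t rule: linorder_cases)
    case less
    have "((\<lambda>x. 0) has_real_derivative 2 * max 0 (x - t)) (at x)"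
      using less by simp
    then show ?thesis
      by (rule has_field_derivative_transform_within_open[where S = "{..<t}"]) (use less in auto)
  next
    case greater
    have "((\<lambda>x. (x - t)\<^sup>2) has_real_derivative 2 * max 0 (x - t)) (at x)"
      using greater by (auto intro!: derivative_eq_intros)
    then show ?thesis
      by (rule has_field_derivative_transform_within_open[where S = "{t<..}"]) (use greater in auto)
  next
    case equal
    have "((\<lambda>h :: real. (max 0 h)\<^sup>2 / h) \<longlongrightarrow> 0) (at 0)"
    proof (rule Lim_null_comparison)
      show "\<forall>\<^sub>F h :: real in at 0. norm ((max 0 h)\<^sup>2 / h) \<le> \<bar>h\<bar>"
        by (intro always_eventually) (auto simp: max_def power2_eq_square)
      show "((\<lambda>h :: real. \<bar>h\<bar>) \<longlongrightarrow> 0) (at 0)"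
        by (auto intro!: tendsto_eq_intros)
    qed
    then show ?thesis by (simp add: DERIV_def equal)
  qed
  then have "((\<lambda>x. complex_of_real ((max 0 (x - t))\<^sup>2)) has_vector_derivative
      of_real (2 * max 0 (x - t))) (at x)"
    by (intro has_vector_derivative_of_real)
  then show ?thesis by (rule has_vector_derivative_at_within)
qed

lemma D_eqI:
  assumes "(u has_vector_derivative u') (at x within {0..1})" "x \<in> {0..1}"
  shows "D u x = u'"
  using vector_derivative_within_cbox[of 0 1 x u u'] assms by (simp add: D_def)

lemma D_affine:
  assumes v: "\<And>y. y \<in> {l..r} \<Longrightarrow> v y = p + q * of_real y"
    and lr: "l < r" "0 \<le> l" "r \<le> 1" "x \<in> {l..r}" "l < x \<or> l = 0" "x < r \<or> r = 1"
  shows "D v x = q"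
proof (rule D_eqI)
  \<comment> \<open>The distance to the ends of \<open>[l,r]\<close> other than \<open>x\<close>. If
    \<open>x\<close> is itself an end, it is an end of \<open>[0,1]\<close> too, nothing lies beyond
    it, and \<open>1\<close> is a placeholder.\<close>
  define e where "e = min (if l < x then x - l else 1) (if x < r then r - x else 1)"
  have "((\<lambda>y. p + q * complex_of_real y) has_vector_derivative q) (at x within {0..1})"
    by (auto intro!: derivative_eq_intros)
  then show "(v has_vector_derivative q) (at x within {0..1})"
  proof (rule has_vector_derivative_transform_within)
    show "e > 0" using lr by (auto simp: e_def)
    fix y assume "y \<in> {0..1}" "dist y x < e"
    then have "y \<in> {l..r}"
      using lr by (auto simp: e_def dist_real_def split: if_splits)
    then show "p + q * of_real y = v y" using v by simp
  qed (use lr in auto)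
qed (use lr in auto)

section \<open>The string, and the passage between solutions and discrete data\<close>

locale discrete_string =
  fixes n :: nat and xi g :: "nat \<Rightarrow> real"
  assumes n_pos: "n \<ge> 1"
    and xi_bounds: "\<forall>i\<in>{1..n}. 0 < xi i \<and> xi i < 1"
    and xi_mono: "strict_mono_on {1..n} xi"
    and g_pos: "\<forall>i\<in>{1..n}. g i > 0"
begin

abbreviation "nd \<equiv> node n xi"

definition gap :: "nat \<Rightarrow> real" where
  "gap i = nd (Suc i) - nd i"

lemma nd_less: "i \<le> n \<Longrightarrow> nd i < nd (Suc i)"
  using xi_bounds xi_mono by (auto simp: node_def strict_mono_on_def)

lemma gap_pos: "i \<le> n \<Longrightarrow> gap i > 0"
  using nd_less by (simp add: gap_def)

lemma nd_mono: "i \<le> j \<Longrightarrow> j \<le> Suc n \<Longrightarrow> nd i \<le> nd j"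
proof (induction rule: dec_induct)
  case (step j)
  then show ?case using nd_less[of j] by simp
qed simp

lemma nd_0 [simp]: "nd 0 = 0" and nd_Suc_n [simp]: "nd (Suc n) = 1"
  by (auto simp: node_def)

lemma nd_xi: "i \<in> {1..n} \<Longrightarrow> nd i = xi i"
  by (auto simp: node_def)

lemma nd_bounds: "i \<le> Suc n \<Longrightarrow> 0 \<le> nd i \<and> nd i \<le> 1"
  using nd_mono[of 0 i] nd_mono[of i "Suc n"] by simp

text \<open>The derivative within \<open>[0,1]\<close> restricts to a derivative within the closed
  gap, so at a node it can be read from the quadratic on either side.\<close>

lemma D_quadratic:
  assumes "\<forall>x\<in>{0..1}. u differentiable (at x within {0..1})"
    and "i \<le> n" and u: "\<And>x. x \<in> {nd i..nd (Suc i)} \<Longrightarrow> u x = q0 + q1 * of_real x + q2 * (of_real x)\<^sup>2"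
    and x: "x \<in> {nd i..nd (Suc i)}"
  shows "D u x = q1 + 2 * q2 * of_real x"
proof -
  have sub: "{nd i..nd (Suc i)} \<subseteq> {0..1}"
    using nd_bounds[of i] nd_bounds[of "Suc i"] assms(2) by auto
  have "(u has_vector_derivative D u x) (at x within {0..1})"
    using assms(1) x sub by (auto simp: D_def simp flip: vector_derivative_works)
  then have 1: "(u has_vector_derivative D u x) (at x within {nd i..nd (Suc i)})"
    using sub by (rule has_vector_derivative_within_subset)
  have "((\<lambda>x. q0 + q1 * complex_of_real x + q2 * (complex_of_real x)\<^sup>2)
      has_vector_derivative q1 + 2 * q2 * of_real x) (at x within {nd i..nd (Suc i)})"
    by (rule has_vector_derivative_real_field) (auto intro!: derivative_eq_intros)
  then have 2: "(u has_vector_derivative q1 + 2 * q2 * of_real x) (at x within {nd i..nd (Suc i)})"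
    by (rule has_vector_derivative_transform[rotated 2]) (use u x in auto)
  show ?thesis
    using vector_derivative_unique_within_closed_interval[of "nd i" "nd (Suc i)" x u] 1 2 x nd_less assms(2)
    by simp
qed

lemma D_D_quadratic:
  assumes "\<forall>x\<in>{0..1}. u differentiable (at x within {0..1})"
    and "i \<le> n" and u: "\<And>x. x \<in> {nd i..nd (Suc i)} \<Longrightarrow> u x = q0 + q1 * of_real x + q2 * (of_real x)\<^sup>2"
  shows "x \<in> {nd i<..<nd (Suc i)} \<Longrightarrow> D (D u) x = 2 * q2"
    and "i = 0 \<Longrightarrow> D (D u) 0 = 2 * q2" and "i = n \<Longrightarrow> D (D u) 1 = 2 * q2"
proof -
  note a = D_affine[where v = "D u" and p = q1 and q = "2 * q2", OF D_quadratic[OF assms]]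
  have b: "nd i < nd (Suc i)" "0 \<le> nd i" "nd (Suc i) \<le> 1"
    using nd_less nd_bounds[of i] nd_bounds[of "Suc i"] assms(2) by auto
  show "x \<in> {nd i<..<nd (Suc i)} \<Longrightarrow> D (D u) x = 2 * q2"
    by (rule a[of "nd i" "nd (Suc i)"]) (use b in auto)
  show "i = 0 \<Longrightarrow> D (D u) 0 = 2 * q2"
    by (rule a[of "nd i" "nd (Suc i)"]) (use b in auto)
  show "i = n \<Longrightarrow> D (D u) 1 = 2 * q2"
    by (rule a[of "nd i" "nd (Suc i)"]) (use b in auto)
qed

lemma D_D_limits:
  assumes "\<forall>x\<in>{0..1}. u differentiable (at x within {0..1})"
    and u: "\<And>i x. i \<le> n \<Longrightarrow> x \<in> {nd i..nd (Suc i)} \<Longrightarrow>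
          u x = q0 i + q1 i * of_real x + q2 i * (of_real x)\<^sup>2"
    and i: "i < n"
  shows "(D (D u) \<longlongrightarrow> 2 * q2 i) (at_left (xi (Suc i)))"
    and "(D (D u) \<longlongrightarrow> 2 * q2 (Suc i)) (at_right (xi (Suc i)))"
proof -
  have xi: "xi (Suc i) = nd (Suc i)" using i by (simp add: nd_xi)
  have "\<forall>\<^sub>F x in at_left (nd (Suc i)). x \<in> {nd i<..<nd (Suc i)}"
    using nd_less[of i] i by (intro eventually_at_left_real) auto
  then have "\<forall>\<^sub>F x in at_left (nd (Suc i)). D (D u) x = 2 * q2 i"
    by (rule eventually_mono) (rule D_D_quadratic(1)[OF assms(1) _ u], use i in auto)
  then show "(D (D u) \<longlongrightarrow> 2 * q2 i) (at_left (xi (Suc i)))"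
    unfolding xi by (rule tendsto_eventually)
  have "\<forall>\<^sub>F x in at_right (nd (Suc i)). x \<in> {nd (Suc i)<..<nd (Suc (Suc i))}"
    using nd_less[of "Suc i"] i by (intro eventually_at_right_real) auto
  then have "\<forall>\<^sub>F x in at_right (nd (Suc i)). D (D u) x = 2 * q2 (Suc i)"
    by (rule eventually_mono) (rule D_D_quadratic(1)[OF assms(1) _ u], use i in auto)
  then show "(D (D u) \<longlongrightarrow> 2 * q2 (Suc i)) (at_right (xi (Suc i)))"
    unfolding xi by (rule tendsto_eventually)
qed

text \<open>The curvature on a gap is twice the leading coefficient of the quadratic there.
  Uniqueness of one-sided limits identifies \<open>l\<close> and \<open>r\<close> of the jump
  condition with these curvatures.\<close>

lemma string_data_of_solution:
  assumes "cubic_string_solution n xi g \<kappa> u"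
  obtains c where "string_data n gap g \<kappa> (\<lambda>i. u (nd i)) (\<lambda>i. D u (nd i)) c"
    "c 0 = D (D u) 0" "c n = D (D u) 1"
proof -
  have diff: "\<forall>x\<in>{0..1}. u differentiable (at x within {0..1})"
    using assms by (simp add: cubic_string_solution_def)
  have "\<forall>i\<in>{..n}. \<exists>q. \<forall>x\<in>{nd i..nd (Suc i)}.
      u x = fst q + fst (snd q) * of_real x + snd (snd q) * (of_real x)\<^sup>2"
    using assms by (auto simp: cubic_string_solution_def)
  from bchoice[OF this] obtain q where q: "\<forall>i\<in>{..n}. \<forall>x\<in>{nd i..nd (Suc i)}.
      u x = fst (q i) + fst (snd (q i)) * of_real x + snd (snd (q i)) * (of_real x)\<^sup>2"
    by blast
  define q0 q1 q2 where "q0 = (\<lambda>i. fst (q i))" and "q1 = (\<lambda>i. fst (snd (q i)))"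
    and "q2 = (\<lambda>i. snd (snd (q i)))"
  have u: "u x = q0 i + q1 i * of_real x + q2 i * (of_real x)\<^sup>2"
    if "i \<le> n" "x \<in> {nd i..nd (Suc i)}" for i x
    using q that by (simp add: q0_def q1_def q2_def)
  have Du: "D u x = q1 i + 2 * q2 i * of_real x" if "i \<le> n" "x \<in> {nd i..nd (Suc i)}" for i x
    using D_quadratic[OF diff that(1) u[OF that(1)] that(2)] by simp
  have "string_data n gap g \<kappa> (\<lambda>i. u (nd i)) (\<lambda>i. D u (nd i)) (\<lambda>i. 2 * q2 i)"
    unfolding string_data_def
  proof (intro conjI allI impI)
    fix i assume i: "i \<le> n"
    then have m: "nd i \<in> {nd i..nd (Suc i)}" "nd (Suc i) \<in> {nd i..nd (Suc i)}"
      using nd_less[of i] by auto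
    show "D u (nd (Suc i)) = D u (nd i) + of_real (gap i) * (2 * q2 i)"
      "u (nd (Suc i)) = u (nd i) + of_real (gap i) * D u (nd i) + (of_real (gap i))\<^sup>2 / 2 * (2 * q2 i)"
      unfolding Du[OF i m(1)] Du[OF i m(2)] u[OF i m(1)] u[OF i m(2)] gap_def
      by (simp_all add: field_simps power2_eq_square)
  next
    fix i assume i: "i < n"
    then have "Suc i \<in> {1..n}" by simp
    then obtain l r where lr: "(D (D u) \<longlongrightarrow> l) (at_left (xi (Suc i)))"
        "(D (D u) \<longlongrightarrow> r) (at_right (xi (Suc i)))"
        "r - l = \<kappa> * of_real (g (Suc i)) * u (xi (Suc i))"
      using assms unfolding cubic_string_solution_def by blast
    have "l = 2 * q2 i"
      by (rule tendsto_unique[OF _ lr(1) D_D_limits(1)[OF diff u i]]) auto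
    moreover have "r = 2 * q2 (Suc i)"
      by (rule tendsto_unique[OF _ lr(2) D_D_limits(2)[OF diff u i]]) auto
    ultimately show "2 * q2 (Suc i) = 2 * q2 i + \<kappa> * of_real (g (Suc i)) * u (nd (Suc i))"
      using lr(3) i by (simp add: nd_xi algebra_simps)
  qed
  moreover have "2 * q2 0 = D (D u) 0" "2 * q2 n = D (D u) 1"
    using D_D_quadratic(2)[OF diff le0 u[OF le0]] D_D_quadratic(3)[OF diff order_refl u[OF order_refl]]
    by auto
  ultimately show ?thesis using that by blast
qed

text \<open>Existence, by an explicit formula: the Taylor polynomial at \<open>0\<close> plus one
  truncated square per mass, weighted by half the jump \<open>w k\<close> of the second
  derivative.\<close>

lemma solution_of_string_data:
  assumes "string_data n gap g \<kappa> a b c"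
  obtains u where "cubic_string_solution n xi g \<kappa> u"
    "\<And>i. i \<le> Suc n \<Longrightarrow> u (nd i) = a i" "\<And>i. i \<le> Suc n \<Longrightarrow> D u (nd i) = b i"
    "D (D u) 0 = c 0" "D (D u) 1 = c n"
proof -
  define w where "w = (\<lambda>k. \<kappa> * of_real (g k) * a k)"
  define u where "u = (\<lambda>x. a 0 + b 0 * of_real x + c 0 / 2 * (of_real x)\<^sup>2
      + (\<Sum>k=1..n. w k / 2 * of_real ((max 0 (x - nd k))\<^sup>2)))"
  define u1 where "u1 = (\<lambda>x. b 0 + c 0 * of_real x + (\<Sum>k=1..n. w k * of_real (max 0 (x - nd k))))"
  have gap: "a (Suc i) = a i + of_real (gap i) * b i + (of_real (gap i))\<^sup>2 / 2 * c i"
      "b (Suc i) = b i + of_real (gap i) * c i" if "i \<le> n" for i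
    using assms that by (auto simp: string_data_def)
  have jump: "c (Suc i) = c i + w (Suc i)" if "i < n" for i
    using assms that by (auto simp: string_data_def w_def)
  have der: "(u has_vector_derivative u1 x) (at x within {0..1})" for x
  proof -
    have 1: "((\<lambda>x. a 0 + b 0 * complex_of_real x + c 0 / 2 * (complex_of_real x)\<^sup>2)
        has_vector_derivative b 0 + c 0 * of_real x) (at x within {0..1})"
      by (rule has_vector_derivative_real_field) (auto intro!: derivative_eq_intros)
    have "((\<lambda>x. w k / 2 * complex_of_real ((max 0 (x - nd k))\<^sup>2))
        has_vector_derivative w k / 2 * of_real (2 * max 0 (x - nd k))) (at x within {0..1})" for k
      by (intro has_vector_derivative_mult_right has_vector_derivative_sq_pos_part)
    then have 2: "((\<lambda>x. w k / 2 * complex_of_real ((max 0 (x - nd k))\<^sup>2))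
        has_vector_derivative w k * of_real (max 0 (x - nd k))) (at x within {0..1})" for k
      by simp
    show ?thesis
      unfolding u_def u1_def
      by (intro has_vector_derivative_add[OF 1] has_vector_derivative_sum 2)
  qed
  have diff: "\<forall>x\<in>{0..1}. u differentiable (at x within {0..1})"
    using der by (auto intro: differentiableI_vector)
  have Du: "D u x = u1 x" if "x \<in> {0..1}" for x
    using D_eqI[OF der that] .
  have "continuous_on {0..1} u1"
    unfolding u1_def by (intro continuous_intros)
  then have cont: "continuous_on {0..1} (D u)"
    by (subst continuous_on_cong[OF refl Du]) auto
  \<comment> \<open>Expanding about node \<open>i\<close> gives the initial polynomial plus the
    squares of the first \<open>i\<close> masses. These are exactly the truncated squares active on
    gap \<open>i\<close>, which yields \<open>quad\<close>.\<close>
  have taylor: "i \<le> n \<Longrightarrow> a i + b i * (t - of_real (nd i)) + c i / 2 * (t - of_real (nd i))\<^sup>2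
      = a 0 + b 0 * t + c 0 / 2 * t\<^sup>2 + (\<Sum>k=1..i. w k / 2 * (t - of_real (nd k))\<^sup>2)" for i t
  proof (induction i)
    case (Suc i)
    then have i: "i \<le> n" "i < n" by auto
    have "a (Suc i) + b (Suc i) * (t - of_real (nd (Suc i))) + c (Suc i) / 2 * (t - of_real (nd (Suc i)))\<^sup>2
      = a i + b i * (t - of_real (nd i)) + c i / 2 * (t - of_real (nd i))\<^sup>2
        + w (Suc i) / 2 * (t - of_real (nd (Suc i)))\<^sup>2"
      unfolding gap[OF i(1)] jump[OF i(2)] gap_def
      by (simp add: algebra_simps power2_eq_square add_divide_distrib diff_divide_distrib)
    then show ?case using Suc i by simp
  qed simp
  define q0 where "q0 = (\<lambda>i. a i - b i * of_real (nd i) + c i / 2 * (of_real (nd i))\<^sup>2)"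
  define q1 where "q1 = (\<lambda>i. b i - c i * of_real (nd i))"
  have quad: "u x = q0 i + q1 i * of_real x + c i / 2 * (of_real x)\<^sup>2"
    if i: "i \<le> n" and x: "x \<in> {nd i..nd (Suc i)}" for i x
  proof -
    have "(\<Sum>k=1..n. w k / 2 * complex_of_real ((max 0 (x - nd k))\<^sup>2))
        = (\<Sum>k=1..i. w k / 2 * (of_real x - of_real (nd k))\<^sup>2)"
    proof (rule sum.mono_neutral_cong_right)
      show "\<forall>k\<in>{1..n} - {1..i}. w k / 2 * complex_of_real ((max 0 (x - nd k))\<^sup>2) = 0"
      proof
        fix k assume "k \<in> {1..n} - {1..i}"
        then have "nd (Suc i) \<le> nd k" by (intro nd_mono) auto
        then have "max 0 (x - nd k) = 0" using x by simp
        then show "w k / 2 * complex_of_real ((max 0 (x - nd k))\<^sup>2) = 0" by simp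
      qed
      fix k assume "k \<in> {1..i}"
      then have "nd k \<le> nd i" using i by (intro nd_mono) auto
      then have "max 0 (x - nd k) = x - nd k" using x by simp
      then show "w k / 2 * complex_of_real ((max 0 (x - nd k))\<^sup>2) = w k / 2 * (of_real x - of_real (nd k))\<^sup>2"
        by simp
    qed (use i in auto)
    then have "u x = a i + b i * (of_real x - of_real (nd i)) + c i / 2 * (of_real x - of_real (nd i))\<^sup>2"
      unfolding taylor[OF i] u_def by simp
    then show ?thesis
      by (simp add: q0_def q1_def algebra_simps power2_eq_square)
  qed
  have a_val: "u (nd i) = a i" and b_val: "D u (nd i) = b i" if "i \<le> n" for i
  proof -
    have m: "nd i \<in> {nd i..nd (Suc i)}" using nd_less[OF that] by simp
    show "u (nd i) = a i"
      unfolding quad[OF that m] q0_def q1_def by (simp add: algebra_simps power2_eq_square)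
    show "D u (nd i) = b i"
      using D_quadratic[OF diff that quad[OF that] m] by (simp add: q1_def)
  qed
  \<comment> \<open>No gap starts at node \<open>Suc n\<close>, so the data there are read at the
    right end of gap \<open>n\<close>.\<close>
  have m: "1 \<in> {nd n..nd (Suc n)}" using nd_less[of n] by simp
  have "u 1 = a (Suc n)"
    unfolding quad[OF order_refl m] gap(1)[OF order_refl] q0_def q1_def gap_def
    by (simp add: field_simps power2_eq_square)
  moreover have "D u 1 = b (Suc n)"
    using D_quadratic[OF diff order_refl quad[OF order_refl] m]
    unfolding gap(2)[OF order_refl] by (simp add: q1_def gap_def algebra_simps)
  ultimately have ab: "u (nd i) = a i" "D u (nd i) = b i" if "i \<le> Suc n" for i
    using a_val[of i] b_val[of i] that by (auto simp: le_Suc_eq)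
  have "cubic_string_solution n xi g \<kappa> u"
    unfolding cubic_string_solution_def
  proof (intro conjI ballI allI impI)
    show "\<exists>c0 c1 c2. \<forall>x\<in>{nd i..nd (Suc i)}. u x = c0 + c1 * of_real x + c2 * (of_real x)\<^sup>2"
      if "i \<le> n" for i using quad[OF that] by blast
    fix j assume "j \<in> {1..n}"
    then obtain i where i: "j = Suc i" "i < n" by (cases j) auto
    show "\<exists>l r. (D (D u) \<longlongrightarrow> l) (at_left (xi j)) \<and> (D (D u) \<longlongrightarrow> r) (at_right (xi j)) \<and>
        r - l = \<kappa> * of_real (g j) * u (xi j)"
    proof (intro exI conjI)
      show "(D (D u) \<longlongrightarrow> 2 * (c i / 2)) (at_left (xi j))"
        "(D (D u) \<longlongrightarrow> 2 * (c (Suc i) / 2)) (at_right (xi j))"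
        unfolding i(1) by (rule D_D_limits[OF diff quad i(2)]; simp)+
      show "2 * (c (Suc i) / 2) - 2 * (c i / 2) = \<kappa> * of_real (g j) * u (xi j)"
        using jump[OF i(2)] ab(1)[of j] i by (simp add: w_def nd_xi field_simps)
    qed
  qed (use diff cont in auto)
  moreover have "D (D u) 0 = c 0" "D (D u) 1 = c n"
    using D_D_quadratic(2)[OF diff le0 quad[OF le0]]
      D_D_quadratic(3)[OF diff order_refl quad[OF order_refl]] by auto
  ultimately show ?thesis using that ab by blast
qed

section \<open>Biorthogonality and the Cauchy pairing\<close>

text \<open>The second derivative at \<open>1\<close> is the curvature of the last gap, which has
  index \<open>n\<close> and not \<open>Suc n\<close>.\<close>

definition end_poly :: "nat \<Rightarrow> complex poly" where
  "end_poly k = (if k = 0 then chain_val gap g (0, 0, 1) (Suc n)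
     else if k = 1 then chain_slope gap g (0, 0, 1) (Suc n)
     else chain_curv gap g (0, 0, 1) n)"

text \<open>Read from the right end, \<open>\<psi>\<^sub>a\<close> obeys the recursion of \<open>\<phi>\<close> for the reversed string.\<close>

definition star_poly :: "nat \<Rightarrow> nat \<Rightarrow> complex poly" where
  "star_poly a i = chain_val (\<lambda>i. gap (n - i)) (\<lambda>i. g (Suc n - i))
     (if a = 2 then 1 else 0, if a = 1 then 1 else 0, if a = 0 then 1 else 0) (Suc n - i)"

abbreviation \<phi> :: "complex \<Rightarrow> real \<Rightarrow> complex" where
  "\<phi> \<equiv> phi n xi g"

text \<open>The sign makes the boundary form at \<open>1\<close> equal to \<open>F_a\<close> with
  coefficient \<open>+1\<close>. It also makes the starting data of the reversed string nonnegative,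
  since reflection negates the slope.\<close>

definition \<psi> :: "nat \<Rightarrow> complex \<Rightarrow> real \<Rightarrow> complex" where
  "\<psi> a z t = (- 1) ^ a * phi_star n xi g a z t"

section \<open>The chosen solutions as polynomials in the spectral parameter\<close>

lemma phi_solution:
  "cubic_string_solution n xi g (- z) (\<phi> z)" "\<phi> z 0 = 0" "D (\<phi> z) 0 = 0" "D (D (\<phi> z)) 0 = 1"
proof -
  obtain u where u: "cubic_string_solution n xi g (- z) u"
    "\<And>i. i \<le> Suc n \<Longrightarrow> u (nd i) = poly (chain_val gap g (0, 0, 1) i) z"
    "\<And>i. i \<le> Suc n \<Longrightarrow> D u (nd i) = poly (chain_slope gap g (0, 0, 1) i) z"
    "D (D u) 0 = poly (chain_curv gap g (0, 0, 1) 0) z"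
    "D (D u) 1 = poly (chain_curv gap g (0, 0, 1) n) z"
    using solution_of_string_data[OF string_data_chain] by metis
  then have "cubic_string_solution n xi g (- z) u \<and> u 0 = 0 \<and> D u 0 = 0 \<and> D (D u) 0 = 1"
    using u(2)[of 0] u(3)[of 0] by simp
  then have "cubic_string_solution n xi g (- z) (\<phi> z) \<and> \<phi> z 0 = 0 \<and> D (\<phi> z) 0 = 0 \<and> D (D (\<phi> z)) 0 = 1"
    unfolding phi_def
    by (rule someI[where P = "\<lambda>u. cubic_string_solution n xi g (- z) u \<and> u 0 = 0 \<and> D u 0 = 0 \<and> D (D u) 0 = 1"])
  then show "cubic_string_solution n xi g (- z) (\<phi> z)" "\<phi> z 0 = 0" "D (\<phi> z) 0 = 0" "D (D (\<phi> z)) 0 = 1"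
    by auto
qed

lemma phi_data:
  obtains c where "string_data n gap g (- z) (\<lambda>i. \<phi> z (nd i)) (\<lambda>i. D (\<phi> z) (nd i)) c"
    "c 0 = 1" "c n = phi_end n xi g 2 z"
proof -
  obtain c where "string_data n gap g (- z) (\<lambda>i. \<phi> z (nd i)) (\<lambda>i. D (\<phi> z) (nd i)) c"
    "c 0 = D (D (\<phi> z)) 0" "c n = D (D (\<phi> z)) 1"
    using string_data_of_solution[OF phi_solution(1)[of z]] by metis
  then show ?thesis
    using that by (auto simp: phi_solution phi_end_def numeral_2_eq_2)
qed

text \<open>Uniqueness of the discrete data pins down at the nodes whatever solution the choice
  operator returns.\<close>

lemma
  shows phi_eq_poly: "i \<le> Suc n \<Longrightarrow> \<phi> z (nd i) = poly (chain_val gap g (0, 0, 1) i) z"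
    and phi_end_eq_poly: "k \<le> 2 \<Longrightarrow> phi_end n xi g k z = poly (end_poly k) z"
proof -
  obtain c where c: "string_data n gap g (- z) (\<lambda>i. \<phi> z (nd i)) (\<lambda>i. D (\<phi> z) (nd i)) c"
    "c 0 = 1" "c n = phi_end n xi g 2 z"
    by (rule phi_data)
  note uniq = string_data_unique[OF c(1) string_data_chain[where s = "(0, 0, 1)"]]
  have v: "i \<le> Suc n \<Longrightarrow> \<phi> z (nd i) = poly (chain_val gap g (0, 0, 1) i) z"
    and d: "i \<le> Suc n \<Longrightarrow> D (\<phi> z) (nd i) = poly (chain_slope gap g (0, 0, 1) i) z"
    and cc: "i \<le> n \<Longrightarrow> c i = poly (chain_curv gap g (0, 0, 1) i) z" for i
    by (rule uniq; simp add: phi_solution c(2))+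
  from v show "i \<le> Suc n \<Longrightarrow> \<phi> z (nd i) = poly (chain_val gap g (0, 0, 1) i) z" .
  show "k \<le> 2 \<Longrightarrow> phi_end n xi g k z = poly (end_poly k) z"
    using v[of "Suc n"] d[of "Suc n"] cc[of n] c(3)
    by (auto simp: le_Suc_eq numeral_2_eq_2 phi_end_def end_poly_def simp del: chain.simps)
qed

lemma star_data:
  "string_data n gap g z (\<lambda>i. poly (star_poly a i) z)
     (\<lambda>i. - poly (chain_slope (\<lambda>i. gap (n - i)) (\<lambda>i. g (Suc n - i))
        (if a = 2 then 1 else 0, if a = 1 then 1 else 0, if a = 0 then 1 else 0) (Suc n - i)) z)
     (\<lambda>i. poly (chain_curv (\<lambda>i. gap (n - i)) (\<lambda>i. g (Suc n - i))
        (if a = 2 then 1 else 0, if a = 1 then 1 else 0, if a = 0 then 1 else 0) (n - i)) z)"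
  unfolding star_poly_def by (rule string_data_reverse[OF string_data_chain])

lemma phi_star_solution:
  fixes z :: complex
  assumes "a \<le> 2"
  defines "u \<equiv> phi_star n xi g a z"
  shows "cubic_string_solution n xi g z u"
    "u 1 = (if a = 2 then 1 else 0)" "D u 1 = (if a = 1 then 1 else 0)"
    "D (D u) 1 = (if a = 0 then 1 else 0)"
proof -
  have one: "poly (if P then 1 else 0) z = (if P then 1 else 0)" for P
    by simp
  \<comment> \<open>The witness is the reversed chain times \<open>(- 1) ^ a\<close>, which cancels
    the sign that reflection gives to the slope for \<open>a = 1\<close>.\<close>
  obtain v where v: "cubic_string_solution n xi g z v"
    "v (nd (Suc n)) = (- 1) ^ a * (if a = 2 then 1 else 0)"
    "D v (nd (Suc n)) = (- 1) ^ a * - (if a = 1 then 1 else 0)"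
    "D (D v) 1 = (- 1) ^ a * (if a = 0 then 1 else 0)"
  proof (rule solution_of_string_data[OF string_data_scale[OF star_data[where a = a and z = z],
        where t = "(- 1) ^ a"]])
    fix v assume v: "cubic_string_solution n xi g z v"
      "\<And>i. i \<le> Suc n \<Longrightarrow> v (nd i) = (- 1) ^ a * poly (star_poly a i) z"
      "\<And>i. i \<le> Suc n \<Longrightarrow> D v (nd i) = (- 1) ^ a * - poly (chain_slope (\<lambda>i. gap (n - i)) (\<lambda>i. g (Suc n - i))
        (if a = 2 then 1 else 0, if a = 1 then 1 else 0, if a = 0 then 1 else 0) (Suc n - i)) z"
      "D (D v) 1 = (- 1) ^ a * poly (chain_curv (\<lambda>i. gap (n - i)) (\<lambda>i. g (Suc n - i))
        (if a = 2 then 1 else 0, if a = 1 then 1 else 0, if a = 0 then 1 else 0) (n - n)) z"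
    show thesis
      by (rule that[OF v(1)]; (subst v; simp only: star_poly_def diff_self_eq_0 chain.simps fst_conv snd_conv one order_refl)?)
  qed
  have "cubic_string_solution n xi g z v \<and> v 1 = (if a = 2 then 1 else 0) \<and>
      D v 1 = (if a = 1 then 1 else 0) \<and> D (D v) 1 = (if a = 0 then 1 else 0)"
    using v by auto
  then have "cubic_string_solution n xi g z u \<and> u 1 = (if a = 2 then 1 else 0) \<and>
      D u 1 = (if a = 1 then 1 else 0) \<and> D (D u) 1 = (if a = 0 then 1 else 0)"
    unfolding u_def phi_star_def
    by (rule someI[where P = "\<lambda>u. cubic_string_solution n xi g z u \<and> u 1 = (if a = 2 then 1 else 0) \<and>
      D u 1 = (if a = 1 then 1 else 0) \<and> D (D u) 1 = (if a = 0 then 1 else 0)"])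
  then show "cubic_string_solution n xi g z u"
    "u 1 = (if a = 2 then 1 else 0)" "D u 1 = (if a = 1 then 1 else 0)"
    "D (D u) 1 = (if a = 0 then 1 else 0)"
    by auto
qed

lemma psi_data:
  assumes "a \<le> 2"
  obtains b c where "string_data n gap g z (\<lambda>i. \<psi> a z (nd i)) b c"
    "\<psi> a z 1 = (if a = 2 then 1 else 0)" "b (Suc n) = (if a = 1 then - 1 else 0)"
    "c n = (if a = 0 then 1 else 0)"
proof -
  let ?u = "phi_star n xi g a z"
  obtain c where "string_data n gap g z (\<lambda>i. ?u (nd i)) (\<lambda>i. D ?u (nd i)) c"
    "c n = D (D ?u) 1"
    using string_data_of_solution[OF phi_star_solution(1)[OF assms, of z]] by metis
  then show ?thesis
    using phi_star_solution[OF assms, of z]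
    by (intro that[of "\<lambda>i. (- 1) ^ a * D ?u (nd i)" "\<lambda>i. (- 1) ^ a * c i"])
      (auto simp: \<psi>_def intro: string_data_scale)
qed

lemma psi_eq_poly:
  assumes "a \<le> 2" "i \<le> Suc n"
  shows "\<psi> a z (nd i) = poly (star_poly a i) z"
proof -
  obtain b c where bc: "string_data n gap g z (\<lambda>i. \<psi> a z (nd i)) b c"
    "\<psi> a z 1 = (if a = 2 then 1 else 0)" "b (Suc n) = (if a = 1 then - 1 else 0)"
    "c n = (if a = 0 then 1 else 0)"
    by (rule psi_data[OF assms(1)])
  show ?thesis
    by (rule string_data_unique_right[OF bc(1) star_data])
      (use assms(2) bc in \<open>auto simp: star_poly_def\<close>)
qed

text \<open>Seen from the right, \<open>n - i\<close> masses are crossed before node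
  \<open>i\<close> is reached.\<close>

lemma degree_star_poly:
  assumes "a \<le> 2" "i \<le> n"
  shows "degree (star_poly a i) = n - i"
proof -
  \<comment> \<open>Puts the 0/1 end conditions into the form of real constants that
    \<open>degree_chain_val\<close> expects.\<close>
  have *: "(if P then 1 else 0 :: complex poly) = [:of_real (if P then 1 else 0):]" for P
    by (simp add: one_pCons)
  show ?thesis
    unfolding star_poly_def Suc_diff_le[OF assms(2)]
    by (rule degree_chain_val[where n = n, OF _ _ arg_cong2[where f = Pair, OF * arg_cong2[where f = Pair, OF * *]]])
      (use assms gap_pos in \<open>auto intro!: g_pos[rule_format]\<close>)
qed

lemma phi_end_1: "phi_end n xi g 0 z = \<phi> z 1" "phi_end n xi g (Suc 0) z = D (\<phi> z) 1"
  by (simp_all add: phi_end_def)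

section \<open>Lagrange identities for the string\<close>

text \<open>The end conditions leave one boundary term on each side: \<open>F_a\<close> at
  \<open>1\<close>, and the value of \<psi> at \<open>0\<close>, where the second derivative of
  \<phi> is \<open>1\<close>.\<close>

lemma phi_psi_Lagrange:
  assumes "a \<le> 2"
  shows "phi_end n xi g a z - \<psi> a w 0
    = (w - z) * (\<Sum>i=1..n. of_real (g i) * \<phi> z (xi i) * \<psi> a w (xi i))"
proof -
  obtain c where c: "string_data n gap g (- z) (\<lambda>i. \<phi> z (nd i)) (\<lambda>i. D (\<phi> z) (nd i)) c"
    "c 0 = 1" "c n = phi_end n xi g 2 z"
    by (rule phi_data)
  obtain b' c' where c': "string_data n gap g w (\<lambda>i. \<psi> a w (nd i)) b' c'"
    "\<psi> a w 1 = (if a = 2 then 1 else 0)" "b' (Suc n) = (if a = 1 then - 1 else 0)"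
    "c' n = (if a = 0 then 1 else 0)"
    by (rule psi_data[OF assms])
  have "(\<Sum>i=1..n. of_real (g i) * \<phi> z (nd i) * \<psi> a w (nd i))
      = (\<Sum>i=1..n. of_real (g i) * \<phi> z (xi i) * \<psi> a w (xi i))"
    by (intro sum.cong) (auto simp: nd_xi)
  moreover have "a = 0 \<or> a = 1 \<or> a = 2" using assms by auto
  ultimately show ?thesis
    using string_data_Lagrange[OF c(1) c'(1)] c c'
    by (auto simp: phi_solution phi_end_1 algebra_simps)
qed

text \<open>Both solutions vanish to first order at \<open>0\<close>, so the whole boundary form
  sits at \<open>1\<close>.\<close>

lemma phi_phi_Lagrange:
  "phi_end n xi g 2 x * phi_end n xi g 0 y - phi_end n xi g 1 x * phi_end n xi g 1 y
      + phi_end n xi g 0 x * phi_end n xi g 2 y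
    = - ((x + y) * (\<Sum>i=1..n. of_real (g i) * \<phi> x (xi i) * \<phi> y (xi i)))"
proof -
  obtain c where c: "string_data n gap g (- x) (\<lambda>i. \<phi> x (nd i)) (\<lambda>i. D (\<phi> x) (nd i)) c"
    "c 0 = 1" "c n = phi_end n xi g 2 x"
    by (rule phi_data)
  obtain c' where c': "string_data n gap g (- y) (\<lambda>i. \<phi> y (nd i)) (\<lambda>i. D (\<phi> y) (nd i)) c'"
    "c' 0 = 1" "c' n = phi_end n xi g 2 y"
    by (rule phi_data)
  have "(\<Sum>i=1..n. of_real (g i) * \<phi> x (nd i) * \<phi> y (nd i))
      = (\<Sum>i=1..n. of_real (g i) * \<phi> x (xi i) * \<phi> y (xi i))"
    by (intro sum.cong) (auto simp: nd_xi)
  then show ?thesis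
    using string_data_Lagrange[OF c(1) c'(1)] c c'
    by (simp add: phi_solution phi_end_1 algebra_simps)
qed

lemma phi_end_eq_psi_0: "a \<le> 2 \<Longrightarrow> phi_end n xi g a z = \<psi> a z 0"
  using phi_psi_Lagrange[of a z z] by simp

section \<open>The spectra\<close>

text \<open>\<open>degree_chain_val\<close> gives exact degrees for values only. Slope and curvature
  at \<open>1\<close> are therefore rewritten as the value of \<psi> at \<open>0\<close>.\<close>

lemma degree_end_poly:
  assumes "a \<le> 2"
  shows "degree (end_poly a) = n"
proof -
  have "poly (end_poly a) = poly (star_poly a 0)"
    using phi_end_eq_psi_0[OF assms] psi_eq_poly[OF assms, of 0] phi_end_eq_poly[OF assms] by auto
  then have "end_poly a = star_poly a 0"
    by (simp add: poly_eq_poly_eq_iff)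
  then show ?thesis using degree_star_poly[OF assms] by simp
qed

lemma end_poly_root:
  assumes "a \<le> 2" "poly (end_poly a) z = 0"
  shows "Im z = 0" "Re z > 0" "poly (pderiv (end_poly a)) z \<noteq> 0"
proof -
  have "a = 0 \<or> a = 1 \<or> a = 2" using assms by auto
  then have "end_poly a \<in> {end_poly 0, end_poly 1, end_poly 2}" by auto
  moreover have "interlacing (Re z) ((Im z)\<^sup>2) (jet z (end_poly 0)) (jet z (end_poly 1)) (jet z (end_poly 2)) \<and>
    bez (jet z (end_poly 0)) (jet z (end_poly 1)) > 0 \<and> bez (jet z (end_poly 0)) (jet z (end_poly 2)) > 0
    \<and> bez (jet z (end_poly 1)) (jet z (end_poly 2)) > 0"
    using interlacing_chain[of n gap g z] gap_pos g_pos n_pos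
    by (simp add: end_poly_def del: chain.simps)
  ultimately have "Im z = 0 \<and> Re z > 0 \<and> poly (pderiv (end_poly a)) z \<noteq> 0"
    using assms(2) by (intro interlacing_root) auto
  then show "Im z = 0" "Re z > 0" "poly (pderiv (end_poly a)) z \<noteq> 0" by auto
qed

lemma spectrum_eq: "a \<le> 2 \<Longrightarrow> string_spectrum n xi g a = {z. poly (end_poly a) z = 0}"
  by (simp add: string_spectrum_def phi_end_eq_poly)

lemma deriv_phi_end: "a \<le> 2 \<Longrightarrow> deriv (phi_end n xi g a) z = poly (pderiv (end_poly a)) z"
proof -
  assume "a \<le> 2"
  then have "phi_end n xi g a = poly (end_poly a)" by (auto simp: phi_end_eq_poly)
  then show ?thesis by (simp add: DERIV_imp_deriv poly_DERIV)
qed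

lemma deriv_phi_end_nonzero:
  "a \<le> 2 \<Longrightarrow> z \<in> string_spectrum n xi g a \<Longrightarrow> deriv (phi_end n xi g a) z \<noteq> 0"
  using end_poly_root(3) by (simp add: spectrum_eq deriv_phi_end)

text \<open>Positivity of the spectra keeps the denominators of the Cauchy kernel away from
  zero.\<close>

lemma spectra_sum_nonzero:
  assumes "a \<le> 2" "b \<le> 2" "x \<in> string_spectrum n xi g a" "y \<in> string_spectrum n xi g b"
  shows "x + y \<noteq> 0"
proof -
  have "Re x > 0" "Re y > 0"
    using assms end_poly_root(2) by (auto simp: spectrum_eq)
  then show ?thesis by (auto simp: complex_eq_iff)
qed

lemma
  assumes "a \<le> 2"
  shows finite_spectrum: "finite (string_spectrum n xi g a)"
    and card_spectrum: "card (string_spectrum n xi g a) = n"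
proof -
  have "end_poly a \<noteq> 0"
    using degree_end_poly[OF assms] n_pos by auto
  then show "finite (string_spectrum n xi g a)" "card (string_spectrum n xi g a) = n"
    using poly_roots_finite card_simple_roots end_poly_root(3)[OF assms] degree_end_poly[OF assms]
    by (auto simp: spectrum_eq[OF assms])
qed

section \<open>Biorthogonality and completeness of the eigenfunctions\<close>

text \<open>On the spectrum both boundary terms of the Lagrange identity vanish, so for
  \<open>x \<noteq> y\<close> the sum does too. On the diagonal the identity is
  differentiated.\<close>

lemma phi_psi_orthogonal:
  assumes a: "a \<le> 2" and x: "x \<in> string_spectrum n xi g a" and y: "y \<in> string_spectrum n xi g a"
  shows "(\<Sum>i=1..n. of_real (g i) * \<phi> x (xi i) * \<psi> a y (xi i))
    = (if x = y then - deriv (phi_end n xi g a) x else 0)"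
proof (cases "x = y")
  case False
  have "\<psi> a y 0 = 0" "phi_end n xi g a x = 0"
    using x y by (auto simp: string_spectrum_def simp flip: phi_end_eq_psi_0[OF a])
  then show ?thesis
    using phi_psi_Lagrange[OF a, of x y] False by simp
next
  case True
  \<comment> \<open>The inner product with the parameter of \<psi> frozen at \<open>x\<close>, as a
    polynomial in that of \<phi>. Then \<open>F_a(z) = (x - z) S(z)\<close>, whose derivative at
    \<open>x\<close> is \<open>- S(x)\<close>.\<close>
  define S where "S = (\<Sum>i=1..n. Polynomial.smult (of_real (g i) * \<psi> a x (xi i)) (chain_val gap g (0, 0, 1) i))"
  have S: "poly S z = (\<Sum>i=1..n. of_real (g i) * \<phi> z (xi i) * \<psi> a x (xi i))" for z
    unfolding S_def poly_sum
    by (intro sum.cong) (auto simp: mult_ac phi_eq_poly simp del: chain.simps simp flip: nd_xi)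
  have "\<psi> a x 0 = 0"
    using x by (auto simp: string_spectrum_def simp flip: phi_end_eq_psi_0[OF a])
  then have "poly (end_poly a) z = poly ([:x, - 1:] * S) z" for z
    using phi_psi_Lagrange[OF a, of z x] by (simp add: S phi_end_eq_poly[OF a] algebra_simps)
  then have "end_poly a = [:x, - 1:] * S"
    by (simp add: poly_eq_poly_eq_iff[symmetric] fun_eq_iff)
  then have "poly (pderiv (end_poly a)) x = - poly S x"
    by (simp only: pderiv_mult) (simp add: pderiv_pCons)
  then show ?thesis
    using True S[of x] by (simp add: deriv_phi_end[OF a])
qed

text \<open>There are \<open>n\<close> eigenvalues and \<open>n\<close> masses, so the biorthogonal
  system is square and \<open>dual_system_swap\<close> applies. The weight \<open>g k\<close> is
  attached to the \<phi> factor and divided out at the end.\<close>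

lemma phi_psi_complete:
  assumes a: "a \<le> 2" and kl: "k \<in> {1..n}" "l \<in> {1..n}"
  shows "(\<Sum>x\<in>string_spectrum n xi g a. \<phi> x (xi k) * \<psi> a x (xi l) / (- deriv (phi_end n xi g a) x))
    = (if k = l then 1 / of_real (g k) else 0)"
proof -
  let ?S = "string_spectrum n xi g a" and ?d = "\<lambda>x. - deriv (phi_end n xi g a) x"
  have gk: "complex_of_real (g k) \<noteq> 0" using g_pos[rule_format, OF kl(1)] by auto
  have "(\<Sum>x\<in>?S. (of_real (g k) * \<phi> x (xi k) / ?d x) * \<psi> a x (xi l)) = (if k = l then 1 else 0)"
  proof (rule dual_system_swap[where K = "{1..n}"])
    fix x y assume xy: "x \<in> ?S" "y \<in> ?S"
    have "(\<Sum>k=1..n. of_real (g k) * \<phi> x (xi k) / ?d x * \<psi> a y (xi k))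
        = (\<Sum>k=1..n. of_real (g k) * \<phi> x (xi k) * \<psi> a y (xi k)) / ?d x"
      by (simp only: sum_divide_distrib times_divide_eq_left)
    also have "\<dots> = (if x = y then 1 else 0)"
      unfolding phi_psi_orthogonal[OF a xy] using deriv_phi_end_nonzero[OF a xy(1)] by auto
    finally show "(\<Sum>k=1..n. of_real (g k) * \<phi> x (xi k) / ?d x * \<psi> a y (xi k)) = (if x = y then 1 else 0)" .
  qed (use a kl in \<open>simp_all add: finite_spectrum card_spectrum\<close>)
  moreover have "(\<Sum>x\<in>?S. (of_real (g k) * \<phi> x (xi k) / ?d x) * \<psi> a x (xi l))
    = of_real (g k) * (\<Sum>x\<in>?S. \<phi> x (xi k) * \<psi> a x (xi l) / ?d x)"
    by (simp add: sum_distrib_left mult_ac)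
  ultimately have "of_real (g k) * (\<Sum>x\<in>?S. \<phi> x (xi k) * \<psi> a x (xi l) / ?d x)
      = (if k = l then 1 else 0)" by simp
  then show ?thesis
    using gk by (auto simp: field_simps)
qed

section \<open>Reduction of the Cauchy pairing to completeness\<close>

text \<open>The function \<phi> at \<open>x\<close> is expanded in the eigenfunctions
  \<open>\<psi> b y\<close>. By the Lagrange identity its coefficients are Cauchy kernels times the
  two weights.\<close>

lemma alpha_beta_transform:
  assumes ab: "(a, b) \<in> {(0, 0), (0, 1), (1, 2), (2, 2)}"
    and x: "x \<in> string_spectrum n xi g a" and l: "l \<in> {1..n}"
  shows "alpha_weight n xi g (a, b) x *
      (\<Sum>y\<in>string_spectrum n xi g b. beta_weight n xi g (a, b) y * (\<psi> b y (xi l) / (x + y)))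
    = \<phi> x (xi l) / (- deriv (phi_end n xi g a) x)"
proof -
  let ?S = "string_spectrum n xi g b" and ?F = "phi_end n xi g"
  let ?d = "\<lambda>y. - deriv (?F b) y"
  have a2: "a \<le> 2" and b2: "b \<le> 2" using ab by auto
  \<comment> \<open>As \<open>F_a(x) = F_b(y) = 0\<close>, the product left over is
    \<open>F_1(x) F_1(y)\<close> for equal types and \<open>F_2(x) F_0(y)\<close> for the other two
    pairs; the signs of the weights fit this case by case.\<close>
  have coeff: "(\<Sum>i=1..n. of_real (g i) * \<phi> x (xi i) * \<phi> y (xi i)) / ?d y
      = alpha_weight n xi g (a, b) x * (- deriv (?F a) x) * beta_weight n xi g (a, b) y / (x + y)"
    if y: "y \<in> ?S" for y
  proof -
    have "x + y \<noteq> 0" using spectra_sum_nonzero[OF a2 b2 x y] .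
    then have s: "(\<Sum>i=1..n. of_real (g i) * \<phi> x (xi i) * \<phi> y (xi i))
        = - (?F 2 x * ?F 0 y - ?F 1 x * ?F 1 y + ?F 0 x * ?F 2 y) / (x + y)"
      unfolding phi_phi_Lagrange by simp
    have "?F a x = 0" "?F b y = 0" using x y by (auto simp: string_spectrum_def)
    moreover have "deriv (?F a) x \<noteq> 0" "deriv (?F b) y \<noteq> 0"
      using deriv_phi_end_nonzero a2 b2 x y by auto
    ultimately show ?thesis
      unfolding s using ab by (auto simp: alpha_weight_def beta_weight_def Let_def)
  qed
  \<comment> \<open>Writes the value as a sum against a weighted Kronecker delta, for which
    completeness of Type \<open>b\<close> is then substituted.\<close>
  have "\<phi> x (xi l) = (\<Sum>i=1..n. of_real (g i) * \<phi> x (xi i) * (if i = l then 1 / of_real (g i) else 0))"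
  proof -
    have "(\<Sum>i=1..n. of_real (g i) * \<phi> x (xi i) * (if i = l then 1 / of_real (g i) else 0))
      = (\<Sum>i=1..n. if i = l then \<phi> x (xi i) else 0)"
      using g_pos[rule_format, OF l] by (intro sum.cong) auto
    then show ?thesis using l by simp
  qed
  also have "\<dots> = (\<Sum>i=1..n. of_real (g i) * \<phi> x (xi i) * (\<Sum>y\<in>?S. \<phi> y (xi i) * \<psi> b y (xi l) / ?d y))"
    using l by (intro sum.cong) (simp_all only: phi_psi_complete[OF b2])
  also have "\<dots> = (\<Sum>y\<in>?S. (\<Sum>i=1..n. of_real (g i) * \<phi> x (xi i) * \<phi> y (xi i)) / ?d y * \<psi> b y (xi l))"
    unfolding sum_distrib_left sum_distrib_right sum_divide_distrib
    by (subst sum.swap) (simp add: mult_ac)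
  also have "\<dots> = (\<Sum>y\<in>?S. alpha_weight n xi g (a, b) x * (- deriv (?F a) x) *
      (beta_weight n xi g (a, b) y * (\<psi> b y (xi l) / (x + y))))"
    by (intro sum.cong refl) (simp only: coeff, simp)
  also have "\<dots> = (- deriv (?F a) x) * (alpha_weight n xi g (a, b) x *
      (\<Sum>y\<in>?S. beta_weight n xi g (a, b) y * (\<psi> b y (xi l) / (x + y))))"
    unfolding sum_distrib_left by (intro sum.cong) (simp_all add: mult_ac)
  finally show ?thesis
    using deriv_phi_end_nonzero[OF a2 x] by simp
qed

text \<open>The sum over \<open>y\<close> is evaluated by \<open>alpha_beta_transform\<close>; what
  remains over \<open>x\<close> is completeness of Type \<open>a\<close>. The factors
  \<open>s\<close> and \<open>t\<close> leave room for the masses in the transforms.\<close>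

lemma cauchy_pairing_psi:
  assumes ab: "(a, b) \<in> {(0, 0), (0, 1), (1, 2), (2, 2)}"
    and kl: "k \<in> {1..n}" "l \<in> {1..n}"
  shows "cauchy_pairing n xi g (a, b) (\<lambda>x. s * \<psi> a x (xi k)) (\<lambda>y. t * \<psi> b y (xi l))
    = (if k = l then s * t / of_real (g k) else 0)"
proof -
  let ?A = "alpha_weight n xi g (a, b)" and ?B = "beta_weight n xi g (a, b)"
  have a2: "a \<le> 2" using ab by auto
  have "?A x * (\<Sum>y\<in>string_spectrum n xi g b.
        ?B y * (s * \<psi> a x (xi k) * (t * \<psi> b y (xi l)) / (x + y)))
      = s * t * (\<phi> x (xi l) * \<psi> a x (xi k) / (- deriv (phi_end n xi g a) x))"
    if "x \<in> string_spectrum n xi g a" for x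
  proof -
    have "?A x * (\<Sum>y\<in>string_spectrum n xi g b.
        ?B y * (s * \<psi> a x (xi k) * (t * \<psi> b y (xi l)) / (x + y)))
      = s * t * \<psi> a x (xi k) * (?A x * (\<Sum>y\<in>string_spectrum n xi g b. ?B y * (\<psi> b y (xi l) / (x + y))))"
      unfolding sum_distrib_left by (intro sum.cong) (simp_all add: mult_ac)
    then show ?thesis
      unfolding alpha_beta_transform[OF ab that kl(2)] by simp
  qed
  then have "cauchy_pairing n xi g (a, b) (\<lambda>x. s * \<psi> a x (xi k)) (\<lambda>y. t * \<psi> b y (xi l))
    = s * t * (\<Sum>x\<in>string_spectrum n xi g a. \<phi> x (xi l) * \<psi> a x (xi k) / (- deriv (phi_end n xi g a) x))"
    unfolding cauchy_pairing_def atomic_integral_def fst_conv snd_conv sum_distrib_left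
    by (intro sum.cong) auto
  then show ?thesis
    unfolding phi_psi_complete[OF a2 kl(2,1)] by simp
qed

section \<open>Transforms of the indicator functions\<close>

text \<open>Each mass lies in its own interval, so by disjointness the indicator sees mass
  \<open>n - j\<close> alone.\<close>

lemma fourier_transform_chi:
  assumes "eps > 0"
    and "disjoint_family_on (\<lambda>i. {xi i - eps <..< xi i + eps}) {1..n}" and j: "j < n"
  shows "fourier_transform n xi g a (chi n xi eps j) = (\<lambda>z. of_real (g (n - j)) * \<psi> a z (xi (n - j)))"
proof
  fix z
  have k: "n - j \<in> {1..n}" using j by auto
  have chi: "chi n xi eps j (xi i) = (if i = n - j then 1 else 0)" if "i \<in> {1..n}" for i
  proof (cases "i = n - j")
    case False
    have "xi i \<in> {xi i - eps <..< xi i + eps}" using assms(1) by simp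
    moreover have "{xi i - eps <..< xi i + eps} \<inter> {xi (n - j) - eps <..< xi (n - j) + eps} = {}"
      using assms(2) that k False unfolding disjoint_family_on_def by blast
    ultimately have "xi i \<notin> {xi (n - j) - eps <..< xi (n - j) + eps}" by blast
    then show ?thesis using False by (simp add: chi_def indicator_def)
  qed (use assms(1) in \<open>simp add: chi_def indicator_def\<close>)
  have "mass_inner n xi g (phi_star n xi g a z) (chi n xi eps j)
      = (\<Sum>i=1..n. if i = n - j then of_real (g i) * phi_star n xi g a z (xi i) else 0)"
    unfolding mass_inner_def by (intro sum.cong) (auto simp: chi)
  then show "fourier_transform n xi g a (chi n xi eps j) z = of_real (g (n - j)) * \<psi> a z (xi (n - j))"
    using k by (simp add: fourier_transform_def \<psi>_def)
qed

text \<open>Counting the masses from the right makes the degree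
  \<open>n - (n - j) = j\<close>.\<close>

lemma fourier_transform_chi_poly:
  assumes "a \<le> 2" "eps > 0"
    and "disjoint_family_on (\<lambda>i. {xi i - eps <..< xi i + eps}) {1..n}" and j: "j < n"
  shows "\<exists>P. degree P = j \<and> (\<forall>z. fourier_transform n xi g a (chi n xi eps j) z = poly P z)"
proof (intro exI conjI allI)
  have k: "n - j \<in> {1..n}" using j by auto
  then have "complex_of_real (g (n - j)) \<noteq> 0" using g_pos[rule_format, of "n - j"] by auto
  then show "degree (Polynomial.smult (of_real (g (n - j))) (star_poly a (n - j))) = j"
    using degree_star_poly[OF assms(1), of "n - j"] j by simp
  show "fourier_transform n xi g a (chi n xi eps j) z
      = poly (Polynomial.smult (of_real (g (n - j))) (star_poly a (n - j))) z" for z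
    using k psi_eq_poly[OF assms(1), of "n - j" z]
    by (simp add: fourier_transform_chi[OF assms(2-4)] nd_xi)
qed

end

theorem theorem3p2:
  fixes n :: nat and xi g :: "nat \<Rightarrow> real" and eps :: real and a b :: nat
    and p q :: "nat \<Rightarrow> complex \<Rightarrow> complex"
  assumes "n \<ge> 1"
    and "\<forall>i\<in>{1..n}. 0 < xi i \<and> xi i < 1"
    and "strict_mono_on {1..n} xi"
    and "\<forall>i\<in>{1..n}. g i > 0"
    and "(a, b) \<in> {(0, 0), (0, 1), (1, 2), (2, 2)}"
    and "eps > 0"
    and "disjoint_family_on (\<lambda>i. {xi i - eps <..< xi i + eps}) {1..n}"
    and "\<And>j x. p j x = fourier_transform n xi g a (chi n xi eps j) x"
    and "\<And>j y. q j y = fourier_transform n xi g b (chi n xi eps j) y"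
  shows "(\<forall>j<n. (\<exists>P :: complex poly. degree P = j \<and> (\<forall>x. p j x = poly P x)) \<and>
                (\<exists>Q :: complex poly. degree Q = j \<and> (\<forall>y. q j y = poly Q y))) \<and>
         (\<forall>i<n. \<forall>j<n. i \<noteq> j \<longrightarrow> cauchy_pairing n xi g (a, b) (p i) (q j) = 0) \<and>
         (\<forall>i<n. cauchy_pairing n xi g (a, b) (p i) (q i) \<noteq> 0)"
proof -
  interpret discrete_string n xi g
    by unfold_locales (use assms in auto)
  have ab: "a \<le> 2" "b \<le> 2" using assms(5) by auto
  have pq: "p j = fourier_transform n xi g a (chi n xi eps j)"
    "q j = fourier_transform n xi g b (chi n xi eps j)" for j
    using assms(8,9) by auto
  \<comment> \<open>Here \<open>s\<close> and \<open>t\<close> are the masses at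
    \<open>n - i\<close> and \<open>n - j\<close>, so the diagonal value is the mass itself. The
    bounds on \<open>i\<close> and \<open>j\<close> keep the truncated subtraction
    injective.\<close>
  have pairing: "cauchy_pairing n xi g (a, b) (p i) (q j) = (if i = j then of_real (g (n - i)) else 0)"
    if "i < n" "j < n" for i j
  proof -
    have k: "n - i \<in> {1..n}" "n - j \<in> {1..n}" "n - i = n - j \<longleftrightarrow> i = j" using that by auto
    show ?thesis
      unfolding pq fourier_transform_chi[OF assms(6,7) that(1)] fourier_transform_chi[OF assms(6,7) that(2)]
        cauchy_pairing_psi[OF assms(5) k(1,2)] k(3) by simp
  qed
  have "g (n - i) \<noteq> 0" if "i < n" for i
  proof -
    have "n - i \<in> {1..n}" using that by auto
    then show ?thesis using g_pos[rule_format, of "n - i"] by linarith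
  qed
  moreover have "\<forall>j<n. (\<exists>P. degree P = j \<and> (\<forall>x. p j x = poly P x)) \<and>
      (\<exists>Q. degree Q = j \<and> (\<forall>y. q j y = poly Q y))"
    unfolding pq using fourier_transform_chi_poly[OF ab(1) assms(6,7)]
      fourier_transform_chi_poly[OF ab(2) assms(6,7)] by blast
  ultimately show ?thesis
    by (simp add: pairing)
qed

end
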